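(* Let $\mathcal{H}$ be a Hilbert space of dimension $d$, let $\rho\in\mathcal{D}(\mathcal{H})$ be a known nominal state and $\alpha\in(0,1)$. Consider the one-sample quantum universal hypothesis testing problem: given $\sigma^{\otimes m}$ for an unknown $\sigma\in\mathcal{D}(\mathcal{H})$, test $H_0:\sigma=\rho$ against $H_1:\sigma\neq\rho$. Then there exist decision rules $M_m$ (depending only on $\rho$, $\alpha$, $m$, not on $\sigma$), using only independent measurements, such that for all sufficiently large $m$, $\alpha(M_m)\le\alpha$, and for every fixed $\sigma\neq\rho$ there is a constant $K$ (which may depend on $\rho,\sigma,\alpha,d$) such that for all sufficiently large $m$, $$\beta(M_m)\le\exp\!\left(-\frac{m\|\rho-\sigma\|_1^2}{86\,d^3}+K m^{1/2}\right).$$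
   Context: $\mathcal{D}(\mathcal{H})$ denotes the set of density operators on $\mathcal{H}$. A decision rule $M_m$ is a two-outcome POVM $\{E_0,E_1\}$ on $\mathcal{H}^{\otimes m}$ (outcome $0$: declare $H_0$; outcome $1$: declare $H_1$). "Independent measurements" means each of the $m$ copies is measured separately and the outcomes are classically processed. Type I error: $\alpha(M_m)=\mathrm{Tr}[\rho^{\otimes m}E_1]$; type II error (for the true state $\sigma$): $\beta(M_m)=\mathrm{Tr}[\sigma^{\otimes m}E_0]$. $\|X\|_1=\mathrm{Tr}\sqrt{X^\dagger X}$ is the trace norm. *)

theory Defs
  imports Complex_Main "Jordan_Normal_Form.Matrix" "Jordan_Normal_Form.Schur_Decomposition"
begin

definition mtrace :: "complex mat \<Rightarrow> complex" where
  "mtrace A = (\<Sum>i < dim_row A. A $$ (i,i))"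

definition psd_mat :: "nat \<Rightarrow> complex mat \<Rightarrow> bool" where
  "psd_mat n A \<longleftrightarrow> A \<in> carrier_mat n n \<and> mat_adjoint A = A \<and>
     (\<forall>v \<in> carrier_vec n. 0 \<le> Re ((A *\<^sub>v v) \<bullet>c v))"

definition density_op :: "nat \<Rightarrow> complex mat \<Rightarrow> bool" where
  "density_op d \<rho> \<longleftrightarrow> psd_mat d \<rho> \<and> mtrace \<rho> = 1"

definition mat_sqrt :: "complex mat \<Rightarrow> complex mat" where
  "mat_sqrt A = (THE B. psd_mat (dim_row A) B \<and> B * B = A)"

definition trace_norm :: "complex mat \<Rightarrow> real" where
  "trace_norm X = Re (mtrace (mat_sqrt (mat_adjoint X * X)))"

definition kron :: "complex mat \<Rightarrow> complex mat \<Rightarrow> complex mat" where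
  "kron A B = mat (dim_row A * dim_row B) (dim_col A * dim_col B)
     (\<lambda>(i,j). A $$ (i div dim_row B, j div dim_col B) * B $$ (i mod dim_row B, j mod dim_col B))"

definition tensor_list :: "complex mat list \<Rightarrow> complex mat" where
  "tensor_list As = foldr kron As (1\<^sub>m 1)"

definition tensor_pow :: "complex mat \<Rightarrow> nat \<Rightarrow> complex mat" where
  "tensor_pow A m = tensor_list (replicate m A)"

definition povm :: "nat \<Rightarrow> complex mat list \<Rightarrow> bool" where
  "povm d N \<longleftrightarrow> (\<forall>E \<in> set N. psd_mat d E) \<and> foldr (+) N (0\<^sub>m d d) = 1\<^sub>m d"

definition outcomes :: "complex mat list list \<Rightarrow> nat list set" where
  "outcomes Ns = {xs. length xs = length Ns \<and> (\<forall>i < length Ns. xs ! i < length (Ns ! i))}"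

text \<open>E1 (the "declare H1" effect of a two-outcome POVM {1-E1, E1} on m copies) arises from
  independent measurements: copy i is measured with POVM Ns!i and the outcome string is
  classically post-processed by f (outcome True = declare H1).
  E1 = sum over outcome strings xs with f xs of the tensor product of the effects (Ns!i)!(xs!i).\<close>
definition indep_test :: "nat \<Rightarrow> nat \<Rightarrow> complex mat \<Rightarrow> bool" where
  "indep_test d m E1 \<longleftrightarrow> (\<exists>Ns f. length Ns = m \<and> (\<forall>i < m. povm d (Ns ! i)) \<and>
     E1 = mat (d ^ m) (d ^ m) (\<lambda>(i,j). \<Sum>xs \<in> outcomes Ns.
            if f xs then tensor_list (map2 (\<lambda>N x. N ! x) Ns xs) $$ (i,j) else 0))"

definition type_I_err :: "complex mat \<Rightarrow> nat \<Rightarrow> complex mat \<Rightarrow> real" where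
  "type_I_err \<rho> m E1 = Re (mtrace (tensor_pow \<rho> m * E1))"

definition type_II_err :: "complex mat \<Rightarrow> nat \<Rightarrow> complex mat \<Rightarrow> real" where
  "type_II_err \<sigma> m E1 = Re (mtrace (tensor_pow \<sigma> m * (1\<^sub>m (dim_row \<sigma> ^ m) - E1)))"

end

theory Submission
  imports Defs "HOL-Computational_Algebra.Fundamental_Theorem_Algebra"
begin

text \<open>Every copy is measured with the same POVM, whose effects are (1/8d) |v><v| for v = e_i + z e_j,
  z a fourth root of unity. The outcome distributions p of \<rho> and q of \<sigma> then
  satisfy |p - q|_1 \<ge> s/2d, where s is the sum of the absolute values of the entries of \<rho> - \<sigma>, and
  s bounds the trace norm from above. Classically, reject when for some set S of outcomes the
  frequency of S exceeds p(S) by C / sqrt m. There are finitely many S, so a Chernoff bound with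
  tilt 1 / sqrt m keeps the type I error below \<alpha> for a suitable constant C; for S = {p \<le> q}, a
  Chernoff bound with tilt \<delta>/2, \<delta> = s/4d, gives the type II exponent
  m \<delta>^2/4 - O(sqrt m) with \<delta>^2/4 = s^2/(64 d^2), already better than the claimed 86 d^3.\<close>

section \<open>Spectral theorem and positive square roots\<close>

text \<open>\<open>mat_sqrt\<close> is a definite description, so \<open>trace_norm\<close> says
  nothing until each positive semidefinite matrix is known to have exactly one such root; the
  spectral theorem serves this purpose alone. The obstacle in the test is that \<sigma> is unknown
  while the most telling set S depends on it. Trying all S multiplies the type I bound by a factor
  that is constant in m, and a threshold of order 1 / sqrt m costs only O(sqrt m) in the type II
  exponent. The weight 1/8d is forced by completeness: the four phases at (i,j) add up to 4
  (|e_i><e_i| + |e_j><e_j|), and all ordered pairs together give 8d times the identity.\<close>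

lemma mat_adjoint_index:
  fixes A :: "complex mat"
  assumes "i < dim_col A" "j < dim_row A"
  shows "mat_adjoint A $$ (i,j) = cnj (A $$ (j,i))"
  using assms by (simp add: mat_adjoint_def mat_of_rows_def)

lemma mat_adjoint_dim [simp]:
  "dim_row (mat_adjoint A) = dim_col A" "dim_col (mat_adjoint A) = dim_row A"
  by (simp_all add: mat_adjoint_def)

lemma mat_adjoint_carrier [simp]: "A \<in> carrier_mat n m \<Longrightarrow> mat_adjoint A \<in> carrier_mat m n"
  by (intro carrier_matI) auto

lemma index_mult_mat_sum:
  assumes "A \<in> carrier_mat n m" "B \<in> carrier_mat m l" "i < n" "j < l"
  shows "(A * B) $$ (i,j) = (\<Sum>k<m. A $$ (i,k) * B $$ (k,j))"
  using assms by (auto simp: scalar_prod_def atLeast0LessThan)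

lemma index_mult_mat_vec_sum:
  assumes "A \<in> carrier_mat n m" "v \<in> carrier_vec m" "i < n"
  shows "(A *\<^sub>v v) $ i = (\<Sum>k<m. A $$ (i,k) * v $ k)"
  using assms by (auto simp: scalar_prod_def atLeast0LessThan)

lemma mat_adjoint_mult:
  fixes A B :: "complex mat"
  assumes "A \<in> carrier_mat n m" "B \<in> carrier_mat m l"
  shows "mat_adjoint (A * B) = mat_adjoint B * mat_adjoint A"
proof (rule eq_matI)
  fix i j assume "i < dim_row (mat_adjoint B * mat_adjoint A)" "j < dim_col (mat_adjoint B * mat_adjoint A)"
  then have ij: "i < l" "j < n" using assms by auto
  have "mat_adjoint (A * B) $$ (i,j) = cnj (\<Sum>k<m. A $$ (j,k) * B $$ (k,i))"
    using assms ij index_mult_mat_sum[OF assms ij(2,1)] by (simp add: mat_adjoint_index)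
  also have "\<dots> = (\<Sum>k<m. mat_adjoint B $$ (i,k) * mat_adjoint A $$ (k,j))"
    using assms ij by (auto simp: mat_adjoint_index ac_simps intro!: sum.cong)
  also have "\<dots> = (mat_adjoint B * mat_adjoint A) $$ (i,j)"
    by (rule index_mult_mat_sum[symmetric]) (use assms ij in auto)
  finally show "mat_adjoint (A * B) $$ (i,j) = (mat_adjoint B * mat_adjoint A) $$ (i,j)" .
qed (use assms in auto)

lemma mat_adjoint_adjoint [simp]: "mat_adjoint (mat_adjoint A) = (A :: complex mat)"
  by (rule eq_matI) (auto simp: mat_adjoint_index)

section \<open>Unitary diagonalisation of Hermitian matrices\<close>

lemma eigenvector_exists:
  fixes A :: "complex mat"
  assumes A: "A \<in> carrier_mat n n" and n: "n \<noteq> 0"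
  obtains v e where "v \<in> carrier_vec n" "v \<noteq> 0\<^sub>v n" "A *\<^sub>v v = e \<cdot>\<^sub>v v"
proof -
  have "degree (char_poly A) \<noteq> 0" using degree_monic_char_poly[OF A] n by auto
  then have "\<not> constant (poly (char_poly A))" by (simp add: constant_degree)
  from fundamental_theorem_of_algebra[OF this] obtain e where "poly (char_poly A) e = 0" by auto
  then have "eigenvalue A e" using eigenvalue_root_char_poly[OF A] by simp
  then show ?thesis using that A unfolding eigenvalue_def eigenvector_def by auto
qed

text \<open>The deflation step of the spectral theorem: Gram-Schmidt applied to a basis that starts
  with \<open>v\<close> keeps \<open>v\<close> in first place, and normalising the columns makes the
  matrix unitary. The scalar \<open>c\<close> stands for the reciprocal of the norm of
  \<open>v\<close>.\<close>

lemma unitary_first_col: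
  fixes v :: "complex vec"
  assumes v: "v \<in> carrier_vec n" and v0: "v \<noteq> 0\<^sub>v n" and n: "n \<noteq> 0"
  obtains W c where "W \<in> carrier_mat n n" "mat_adjoint W * W = 1\<^sub>m n" "\<And>k. k < n \<Longrightarrow> W $$ (k,0) = c * v $ k"
proof -
  interpret cof_vec_space n "TYPE(complex)" .
  define b where "b = basis_completion v"
  define ws where "ws = gram_schmidt n b"
  from basis_completion[OF v v0, folded b_def]
  have dist_b: "distinct b" and indep: "\<not> lin_dep (set b)" and b: "set b \<subseteq> carrier_vec n"
    and hdb: "hd b = v" and len_b: "length b = n" by auto
  from hdb len_b n obtain vs where bv: "b = v # vs" by (cases b, auto)
  from gram_schmidt_result[OF b dist_b indep refl, folded ws_def]
  have ws: "set ws \<subseteq> carrier_vec n" "corthogonal ws" "length ws = n" by (auto simp: len_b)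
  from gram_schmidt_hd[OF v, of vs, folded bv] have hdws: "hd ws = v" unfolding ws_def .
  have ws0: "ws ! 0 = v" using hdws ws(3) n by (cases ws) auto
  have wsc: "ws ! i \<in> carrier_vec n" if "i < n" for i using ws that by auto
  define r where "r i = sqrt (Re (ws ! i \<bullet>c ws ! i))" for i
  \<comment> \<open>Nonnegativity in the order of the complex numbers also makes the inner product
    real, so \<open>r i\<close> is the norm of the vector.\<close>
  have rr: "complex_of_real (r i) * complex_of_real (r i) = ws ! i \<bullet>c ws ! i \<and> r i \<noteq> 0" if i: "i < n" for i
  proof -
    have "ws ! i \<bullet>c ws ! i \<noteq> 0" using corthogonalD[OF ws(2)] i ws(3) by auto
    moreover have "ws ! i \<bullet>c ws ! i \<ge> 0" by (rule conjugate_square_ge_0_vec)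
    ultimately have "Im (ws ! i \<bullet>c ws ! i) = 0" "0 < Re (ws ! i \<bullet>c ws ! i)"
      by (auto simp: less_eq_complex_def complex_eq_iff)
    then show ?thesis unfolding r_def by (auto simp: complex_eq_iff simp flip: of_real_mult)
  qed
  define W where "W = mat n n (\<lambda>(k,i). ws ! i $ k / complex_of_real (r i))"
  have W: "W \<in> carrier_mat n n" by (simp add: W_def)
  have "mat_adjoint W * W = 1\<^sub>m n"
  proof (rule eq_matI)
    fix i j assume "i < dim_row (1\<^sub>m n)" "j < dim_col (1\<^sub>m n)"
    then have ij: "i < n" "j < n" by auto
    have "(mat_adjoint W * W) $$ (i,j) = (\<Sum>k<n. cnj (W $$ (k,i)) * W $$ (k,j))"
      using index_mult_mat_sum[of "mat_adjoint W" n n W n i j] W ij by (simp add: mat_adjoint_index)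
    also have "\<dots> = (ws ! j \<bullet>c ws ! i) / (complex_of_real (r i) * complex_of_real (r j))"
      using ij wsc[of i] wsc[of j]
      by (auto simp: W_def scalar_prod_def atLeast0LessThan sum_divide_distrib intro!: sum.cong)
    also have "\<dots> = (if i = j then 1 else 0)"
      using rr[OF ij(1)] corthogonalD[OF ws(2), of j i] ij ws(3) by auto
    finally show "(mat_adjoint W * W) $$ (i,j) = 1\<^sub>m n $$ (i,j)" using ij by simp
  qed (auto simp: W_def)
  moreover have "W $$ (k,0) = (1 / complex_of_real (r 0)) * v $ k" if "k < n" for k
    using that n by (simp add: W_def ws0)
  ultimately show ?thesis using that W by blast
qed

text \<open>Induction by deflation: in an orthonormal basis whose first vector is an eigenvector,
  the first column vanishes below the diagonal, Hermiticity clears the first row as well, and the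
  remaining block is Hermitian of smaller size.\<close>

lemma hermitian_unitary_diag:
  fixes A :: "complex mat"
  assumes "A \<in> carrier_mat n n" "mat_adjoint A = A"
  shows "\<exists>U. U \<in> carrier_mat n n \<and> mat_adjoint U * U = 1\<^sub>m n \<and> diagonal_mat (mat_adjoint U * A * U)"
  using assms
proof (induction n arbitrary: A)
  case 0
  then show ?case by (intro exI[of _ "1\<^sub>m 0"]) (auto simp: diagonal_mat_def)
next
  case (Suc n A)
  note A = Suc.prems(1) and herm = Suc.prems(2)
  obtain v e where v: "v \<in> carrier_vec (Suc n)" "v \<noteq> 0\<^sub>v (Suc n)" "A *\<^sub>v v = e \<cdot>\<^sub>v v"
    using eigenvector_exists[OF A] by blast
  obtain W c where W: "W \<in> carrier_mat (Suc n) (Suc n)" and WW: "mat_adjoint W * W = 1\<^sub>m (Suc n)"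
    and W0: "\<And>k. k < Suc n \<Longrightarrow> W $$ (k,0) = c * v $ k"
    using unitary_first_col[OF v(1,2)] by blast
  let ?Wa = "mat_adjoint W"
  have Wa: "?Wa \<in> carrier_mat (Suc n) (Suc n)" using W by simp
  define B where "B = ?Wa * A * W"
  have B: "B \<in> carrier_mat (Suc n) (Suc n)" unfolding B_def by (intro mult_carrier_mat[of _ _ "Suc n"] A W Wa)
  have Bherm: "mat_adjoint B = B"
    unfolding B_def using A W Wa herm
    by (simp add: mat_adjoint_mult[of _ "Suc n" "Suc n" _ "Suc n"] assoc_mult_mat[of _ "Suc n" "Suc n" _ "Suc n" _ "Suc n"] mult_carrier_mat[of _ "Suc n" "Suc n" _ "Suc n"])
  \<comment> \<open>The first column of \<open>A * W\<close> is e times that of \<open>W\<close>, so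
    the first column of \<open>B\<close> is e times that of the identity.\<close>
  have B0: "B $$ (i,0) = (if i = 0 then e else 0)" if i: "i < Suc n" for i
  proof -
    have AW: "(A * W) $$ (k,0) = e * W $$ (k,0)" if k: "k < Suc n" for k
    proof -
      have "(A * W) $$ (k,0) = c * (A *\<^sub>v v) $ k"
        using k W0 unfolding index_mult_mat_vec_sum[OF A v(1) k] index_mult_mat_sum[OF A W k zero_less_Suc] sum_distrib_left
        by (intro sum.cong) auto
      then show ?thesis using v k W0[OF k] by simp
    qed
    have "B $$ (i,0) = (?Wa * (A * W)) $$ (i,0)"
      unfolding B_def using A W Wa by (simp add: assoc_mult_mat[of _ "Suc n" "Suc n" _ "Suc n" _ "Suc n"] mult_carrier_mat[of _ "Suc n" "Suc n" _ "Suc n"])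
    also have "\<dots> = (\<Sum>k<Suc n. ?Wa $$ (i,k) * (A * W) $$ (k,0))"
      by (rule index_mult_mat_sum[OF Wa _ i]) (use A W in auto)
    also have "\<dots> = e * (\<Sum>k<Suc n. ?Wa $$ (i,k) * W $$ (k,0))"
      unfolding sum_distrib_left by (intro sum.cong refl) (simp add: AW del: index_mult_mat)
    also have "(\<Sum>k<Suc n. ?Wa $$ (i,k) * W $$ (k,0)) = (?Wa * W) $$ (i,0)"
      by (rule index_mult_mat_sum[OF Wa W i, symmetric]) simp
    finally show ?thesis using i by (simp add: WW del: index_mult_mat)
  qed
  have B0': "B $$ (0,i) = 0" if "0 < i" "i < Suc n" for i
    using B0[of i] that B mat_adjoint_index[of 0 B i] by (simp add: Bherm)
  define B3 where "B3 = mat n n (\<lambda>(i,j). B $$ (Suc i, Suc j))"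
  have B3: "B3 \<in> carrier_mat n n" by (simp add: B3_def)
  have Bblock: "B = four_block_mat (mat 1 1 (\<lambda>_. e)) (0\<^sub>m 1 n) (0\<^sub>m n 1) B3"
    by (rule eq_matI) (use B B0 B0' in \<open>auto simp: B3_def\<close>)
  have "mat_adjoint B3 = B3"
  proof (rule eq_matI)
    fix i j assume "i < dim_row B3" "j < dim_col B3"
    then have ij: "i < n" "j < n" by (auto simp: B3_def)
    have "mat_adjoint B $$ (Suc i, Suc j) = cnj (B $$ (Suc j, Suc i))"
      using B ij by (intro mat_adjoint_index) auto
    then show "mat_adjoint B3 $$ (i,j) = B3 $$ (i,j)"
      using ij by (simp add: mat_adjoint_index B3_def Bherm)
  qed (auto simp: B3_def)
  from Suc.IH[OF B3 this] obtain V where V: "V \<in> carrier_mat n n" "mat_adjoint V * V = 1\<^sub>m n"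
    and Vd: "diagonal_mat (mat_adjoint V * B3 * V)" by blast
  \<comment> \<open>\<open>X\<close> fixes the eigenvector and rotates its complement by
    \<open>V\<close>, which preserves the block shape.\<close>
  define X where "X = four_block_mat (1\<^sub>m 1) (0\<^sub>m 1 n) (0\<^sub>m n 1) V"
  have X: "X \<in> carrier_mat (Suc n) (Suc n)" using V by (auto simp: X_def)
  have Xa: "mat_adjoint X = four_block_mat (1\<^sub>m 1) (0\<^sub>m 1 n) (0\<^sub>m n 1) (mat_adjoint V)"
    by (rule eq_matI) (use V in \<open>auto simp: X_def mat_adjoint_index\<close>)
  have XX: "mat_adjoint X * X = 1\<^sub>m (Suc n)"
    unfolding Xa unfolding X_def
    by (subst mult_four_block_mat[of _ 1 1 _ n _ n _ _ 1 _ n]) (use V in \<open>auto intro!: eq_matI\<close>)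
  have VB: "mat_adjoint V * B3 \<in> carrier_mat n n" "mat_adjoint V * B3 * V \<in> carrier_mat n n"
    using V B3 by (auto intro!: mult_carrier_mat[of _ _ n])
  have Va: "mat_adjoint V \<in> carrier_mat n n" using V by simp
  note block = mult_four_block_mat[of _ 1 1 _ n _ n _ _ 1 _ n]
  have XB: "mat_adjoint X * B = four_block_mat (mat 1 1 (\<lambda>_. e)) (0\<^sub>m 1 n) (0\<^sub>m n 1) (mat_adjoint V * B3)"
    unfolding Xa Bblock using VB Va B3 by (subst block) (auto simp: right_mult_zero_mat[of _ n n])
  have XBX: "mat_adjoint X * B * X = four_block_mat (mat 1 1 (\<lambda>_. e)) (0\<^sub>m 1 n) (0\<^sub>m n 1) (mat_adjoint V * B3 * V)"
    unfolding XB unfolding X_def using VB V by (subst block) auto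
  have diag: "diagonal_mat (mat_adjoint X * B * X)"
    unfolding XBX using Vd V B3 by (auto simp: diagonal_mat_def)
  have U1: "mat_adjoint (W * X) * (W * X) = 1\<^sub>m (Suc n)"
  proof -
    have "mat_adjoint (W * X) * (W * X) = mat_adjoint X * (?Wa * W) * X"
      using W X by (simp add: mat_adjoint_mult[of _ "Suc n" "Suc n" _ "Suc n"] assoc_mult_mat[of _ "Suc n" "Suc n" _ "Suc n" _ "Suc n"] mult_carrier_mat[of _ "Suc n" "Suc n" _ "Suc n"])
    then show ?thesis using X by (simp add: WW XX)
  qed
  have U2: "mat_adjoint (W * X) * A * (W * X) = mat_adjoint X * B * X"
    unfolding B_def using W X A
    by (simp add: mat_adjoint_mult[of _ "Suc n" "Suc n" _ "Suc n"] assoc_mult_mat[of _ "Suc n" "Suc n" _ "Suc n" _ "Suc n"] mult_carrier_mat[of _ "Suc n" "Suc n" _ "Suc n"])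
  show ?case using U1 U2 diag W X by (intro exI[of _ "W * X"]) auto
qed

section \<open>Positive semidefinite matrices and their square roots\<close>

lemma cscalar_prod_sum:
  "v \<in> carrier_vec n \<Longrightarrow> w \<in> carrier_vec n \<Longrightarrow> v \<bullet>c w = (\<Sum>i<n. v $ i * cnj (w $ i))"
  by (simp add: scalar_prod_def atLeast0LessThan)

lemma mat_adjoint_cscalar_prod:
  fixes U :: "complex mat"
  assumes U: "U \<in> carrier_mat n m" and w: "w \<in> carrier_vec n" and v: "v \<in> carrier_vec m"
  shows "(mat_adjoint U *\<^sub>v w) \<bullet>c v = w \<bullet>c (U *\<^sub>v v)"
proof -
  have Ua: "mat_adjoint U \<in> carrier_mat m n" using U by simp
  have "(mat_adjoint U *\<^sub>v w) \<bullet>c v = (\<Sum>i<m. \<Sum>k<n. cnj (U $$ (k,i)) * w $ k * cnj (v $ i))"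
  proof -
    have "(mat_adjoint U *\<^sub>v w) \<bullet>c v = (\<Sum>i<m. (mat_adjoint U *\<^sub>v w) $ i * cnj (v $ i))"
      by (rule cscalar_prod_sum[OF mult_mat_vec_carrier[OF Ua w] v])
    also have "\<dots> = (\<Sum>i<m. \<Sum>k<n. cnj (U $$ (k,i)) * w $ k * cnj (v $ i))"
      unfolding sum_distrib_right[symmetric]
      by (intro sum.cong refl)
        (use U in \<open>simp add: index_mult_mat_vec_sum[OF Ua w] mat_adjoint_index del: index_mult_mat_vec\<close>)
    finally show ?thesis .
  qed
  also have "\<dots> = (\<Sum>k<n. \<Sum>i<m. cnj (U $$ (k,i)) * w $ k * cnj (v $ i))" by (rule sum.swap)
  also have "\<dots> = (\<Sum>k<n. w $ k * cnj ((U *\<^sub>v v) $ k))"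
    by (intro sum.cong refl)
      (simp add: index_mult_mat_vec_sum[OF U v] sum_distrib_left ac_simps del: index_mult_mat_vec)
  also have "\<dots> = w \<bullet>c (U *\<^sub>v v)"
    by (rule cscalar_prod_sum[OF w mult_mat_vec_carrier[OF U v], symmetric])
  finally show ?thesis .
qed

text \<open>The form of the new matrix at v is the form of \<open>A\<close> at U v. \<open>U\<close>
  may be rectangular: with a single row or column this yields the positivity of rank-one effects and
  of their expectations.\<close>

lemma psd_mat_congruence:
  assumes A: "psd_mat n A" and U: "U \<in> carrier_mat n m"
  shows "psd_mat m (mat_adjoint U * A * U)"
proof -
  have Ac: "A \<in> carrier_mat n n" and herm: "mat_adjoint A = A" using A by (auto simp: psd_mat_def)
  have Ua: "mat_adjoint U \<in> carrier_mat m n" using U by simp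
  have "mat_adjoint (mat_adjoint U * A * U) = mat_adjoint U * (A * U)"
    using mat_adjoint_mult[OF mult_carrier_mat[OF Ua Ac] U] mat_adjoint_mult[OF Ua Ac]
    by (simp add: herm)
  then have "mat_adjoint (mat_adjoint U * A * U) = mat_adjoint U * A * U"
    using assoc_mult_mat[OF Ua Ac U] by simp
  moreover have "0 \<le> Re ((mat_adjoint U * A * U *\<^sub>v v) \<bullet>c v)" if v: "v \<in> carrier_vec m" for v
  proof -
    have Uv: "U *\<^sub>v v \<in> carrier_vec n" using U v by (rule mult_mat_vec_carrier)
    have "mat_adjoint U * A * U *\<^sub>v v = mat_adjoint U *\<^sub>v (A *\<^sub>v (U *\<^sub>v v))"
      using assoc_mult_mat_vec[OF mult_carrier_mat[OF Ua Ac] U v] assoc_mult_mat_vec[OF Ua Ac Uv] by simp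
    then have "(mat_adjoint U * A * U *\<^sub>v v) \<bullet>c v = (A *\<^sub>v (U *\<^sub>v v)) \<bullet>c (U *\<^sub>v v)"
      using mat_adjoint_cscalar_prod[OF U _ v, of "A *\<^sub>v (U *\<^sub>v v)"] Ac Uv by simp
    then show ?thesis using A Uv by (simp add: psd_mat_def)
  qed
  moreover have "mat_adjoint U * A * U \<in> carrier_mat m m" using Ua Ac U by (intro mult_carrier_mat)
  ultimately show ?thesis unfolding psd_mat_def by blast
qed

lemma hermitian_index:
  fixes A :: "complex mat"
  assumes "A \<in> carrier_mat n n" "mat_adjoint A = A" "i < n" "j < n"
  shows "A $$ (i,j) = cnj (A $$ (j,i))"
  using mat_adjoint_index[of i A j] assms by simp

lemma psd_mat_diag:
  assumes A: "psd_mat n A" and i: "i < n"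
  shows "A $$ (i,i) = complex_of_real (Re (A $$ (i,i)))" "0 \<le> Re (A $$ (i,i))"
proof -
  have Ac: "A \<in> carrier_mat n n" and herm: "mat_adjoint A = A" using A by (auto simp: psd_mat_def)
  show "A $$ (i,i) = complex_of_real (Re (A $$ (i,i)))"
    using hermitian_index[OF Ac herm i i] by (simp add: complex_eq_iff)
  have "(A *\<^sub>v unit_vec n i) \<bullet>c unit_vec n i = (\<Sum>k<n. (A *\<^sub>v unit_vec n i) $ k * cnj (unit_vec n i $ k))"
    by (rule cscalar_prod_sum[OF mult_mat_vec_carrier[OF Ac]]) auto
  also have "\<dots> = (\<Sum>k<n. if k = i then A $$ (i,i) else 0)"
  proof (intro sum.cong refl)
    fix k assume "k \<in> {..<n}"
    then have k: "k < n" by simp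
    have "(A *\<^sub>v unit_vec n i) $ k = (\<Sum>l<n. A $$ (k,l) * unit_vec n i $ l)"
      by (rule index_mult_mat_vec_sum[OF Ac _ k]) simp
    also have "\<dots> = (\<Sum>l<n. if l = i then A $$ (k,l) else 0)"
      using i by (intro sum.cong) auto
    finally show "(A *\<^sub>v unit_vec n i) $ k * cnj (unit_vec n i $ k) = (if k = i then A $$ (i,i) else 0)"
      using i k by simp
  qed
  finally have "(A *\<^sub>v unit_vec n i) \<bullet>c unit_vec n i = A $$ (i,i)" using i by simp
  then show "0 \<le> Re (A $$ (i,i))" using A by (metis psd_mat_def unit_vec_carrier)
qed

lemma psd_mat_diagonal:
  assumes "\<And>i. i < n \<Longrightarrow> 0 \<le> r i"
  shows "psd_mat n (mat n n (\<lambda>(i,j). if i = j then complex_of_real (r i) else 0))" (is "psd_mat n ?D")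
proof -
  have "mat_adjoint ?D = ?D" by (rule eq_matI) (auto simp: mat_adjoint_index)
  moreover have "0 \<le> Re ((?D *\<^sub>v v) \<bullet>c v)" if v: "v \<in> carrier_vec n" for v
  proof -
    have "(?D *\<^sub>v v) \<bullet>c v = (\<Sum>i<n. (?D *\<^sub>v v) $ i * cnj (v $ i))"
      by (rule cscalar_prod_sum[OF mult_mat_vec_carrier v]) (use v in auto)
    also have "\<dots> = (\<Sum>i<n. complex_of_real (r i * (cmod (v $ i))\<^sup>2))"
    proof (intro sum.cong refl)
      fix i assume "i \<in> {..<n}"
      then have i: "i < n" by simp
      have "(?D *\<^sub>v v) $ i = (\<Sum>k<n. ?D $$ (i,k) * v $ k)"
        by (rule index_mult_mat_vec_sum[OF _ v i]) simp
      also have "\<dots> = (\<Sum>k<n. if k = i then complex_of_real (r i) * v $ i else 0)"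
        using i by (intro sum.cong) auto
      finally have "(?D *\<^sub>v v) $ i = complex_of_real (r i) * v $ i" using i by simp
      then show "(?D *\<^sub>v v) $ i * cnj (v $ i) = complex_of_real (r i * (cmod (v $ i))\<^sup>2)"
        by (simp add: complex_norm_square[symmetric] del: index_mult_mat_vec)
    qed
    finally show ?thesis using assms by (auto intro!: sum_nonneg simp: Re_sum)
  qed
  ultimately show ?thesis by (auto simp: psd_mat_def)
qed

lemma psd_one_mat: "psd_mat n (1\<^sub>m n)"
  using psd_mat_diagonal[of n "\<lambda>_. 1", unfolded of_real_1 one_mat_def[symmetric]] by simp

text \<open>In an eigenbasis the diagonal entries are nonnegative reals by
  \<open>psd_mat_diag\<close>; their roots are taken there and the result is rotated back.\<close>

lemma psd_sqrt_exists:
  assumes A: "psd_mat n A"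
  shows "\<exists>B. psd_mat n B \<and> B * B = A"
proof -
  have Ac: "A \<in> carrier_mat n n" and herm: "mat_adjoint A = A" using A by (auto simp: psd_mat_def)
  obtain U where U: "U \<in> carrier_mat n n" and UU: "mat_adjoint U * U = 1\<^sub>m n"
    and diag: "diagonal_mat (mat_adjoint U * A * U)"
    using hermitian_unitary_diag[OF Ac herm] by blast
  let ?Ua = "mat_adjoint U"
  have Ua: "?Ua \<in> carrier_mat n n" using U by simp
  have UU': "U * ?Ua = 1\<^sub>m n" by (rule mat_mult_left_right_inverse[OF Ua U UU])
  define T where "T = ?Ua * A * U"
  have T: "psd_mat n T" unfolding T_def by (rule psd_mat_congruence[OF A U])
  then have Tc: "T \<in> carrier_mat n n" by (simp add: psd_mat_def)
  define D where "D = mat n n (\<lambda>(i,j). if i = j then complex_of_real (sqrt (Re (T $$ (i,i)))) else 0)"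
  have D: "psd_mat n D" unfolding D_def by (rule psd_mat_diagonal) (use psd_mat_diag[OF T] in auto)
  have Dc: "D \<in> carrier_mat n n" by (simp add: D_def)
  have DD: "D * D = T"
  proof (rule eq_matI)
    fix i j assume "i < dim_row T" "j < dim_col T"
    then have ij: "i < n" "j < n" using Tc by auto
    have "(D * D) $$ (i,j) = (\<Sum>k<n. D $$ (i,k) * D $$ (k,j))"
      by (rule index_mult_mat_sum[OF Dc Dc ij])
    also have "\<dots> = (\<Sum>k<n. if k = i then (if i = j then T $$ (i,i) else 0) else 0)"
      using ij psd_mat_diag[OF T ij(1)]
      by (intro sum.cong) (auto simp: D_def simp flip: of_real_mult)
    also have "\<dots> = T $$ (i,j)"
      using ij diag Tc by (auto simp: diagonal_mat_def T_def)
    finally show "(D * D) $$ (i,j) = T $$ (i,j)" .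
  qed (use Dc Tc in auto)
  define B where "B = U * D * ?Ua"
  have "psd_mat n B" unfolding B_def using psd_mat_congruence[OF D Ua] by simp
  moreover have "B * B = A"
  proof -
    note assoc = assoc_mult_mat[of _ n n _ n _ n] mult_carrier_mat[of _ n n _ n]
    have "B * B = U * (D * (?Ua * U) * D) * ?Ua" unfolding B_def using U Ua Dc by (simp add: assoc)
    also have "\<dots> = U * T * ?Ua" using Dc by (simp add: UU DD)
    also have "\<dots> = (U * ?Ua) * A * (U * ?Ua)" unfolding T_def using U Ua Ac by (simp add: assoc)
    finally show ?thesis using Ac by (simp add: UU')
  qed
  ultimately show ?thesis by blast
qed

text \<open>In an eigenbasis of B - C the two roots agree off the diagonal, so comparing the diagonals
  of their squares makes the nonnegative diagonal entries agree as well.\<close>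
lemma psd_sqrt_unique:
  assumes B: "psd_mat n B" and C: "psd_mat n C" and eq: "B * B = C * C"
  shows "B = C"
proof -
  have Bc: "B \<in> carrier_mat n n" and Cc: "C \<in> carrier_mat n n"
    and Bh: "mat_adjoint B = B" and Ch: "mat_adjoint C = C"
    using B C by (auto simp: psd_mat_def)
  have BC: "B - C \<in> carrier_mat n n" using Cc by (rule minus_carrier_mat)
  have "mat_adjoint (B - C) = B - C"
  proof (rule eq_matI)
    fix i j assume "i < dim_row (B - C)" "j < dim_col (B - C)"
    then have ij: "i < n" "j < n" using Cc by auto
    then show "mat_adjoint (B - C) $$ (i,j) = (B - C) $$ (i,j)"
      using Bc Cc hermitian_index[OF Bc Bh ij] hermitian_index[OF Cc Ch ij]
      by (simp add: mat_adjoint_index)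
  qed (use Bc Cc in auto)
  from hermitian_unitary_diag[OF BC this]
  obtain U where U: "U \<in> carrier_mat n n" and UU: "mat_adjoint U * U = 1\<^sub>m n"
    and diag: "diagonal_mat (mat_adjoint U * (B - C) * U)" by blast
  let ?Ua = "mat_adjoint U"
  have Ua: "?Ua \<in> carrier_mat n n" using U by simp
  have UU': "U * ?Ua = 1\<^sub>m n" by (rule mat_mult_left_right_inverse[OF Ua U UU])
  note assoc = assoc_mult_mat[of _ n n _ n _ n] mult_carrier_mat[of _ n n _ n]
  define B' where "B' = ?Ua * B * U"
  define C' where "C' = ?Ua * C * U"
  have B': "psd_mat n B'" and C': "psd_mat n C'"
    unfolding B'_def C'_def using psd_mat_congruence U B C by auto
  then have B'c: "B' \<in> carrier_mat n n" and C'c: "C' \<in> carrier_mat n n" by (auto simp: psd_mat_def)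
  have "?Ua * (B - C) * U = B' - C'"
    unfolding B'_def C'_def mult_minus_distrib_mat[OF Ua Bc Cc]
    by (rule minus_mult_distrib_mat) (use U Ua Bc Cc in auto)
  then have off: "B' $$ (i,j) = C' $$ (i,j)" if "i < n" "j < n" "i \<noteq> j" for i j
    using diag that B'c C'c by (auto simp: diagonal_mat_def)
  have square: "(?Ua * X * U) * (?Ua * X * U) = ?Ua * (X * X) * U" if X: "X \<in> carrier_mat n n" for X
  proof -
    have "(?Ua * X * U) * (?Ua * X * U) = ?Ua * X * (U * ?Ua) * X * U" using U Ua X by (simp add: assoc)
    then show ?thesis using U Ua X by (simp add: UU' assoc)
  qed
  have sq: "B' * B' = C' * C'"
    unfolding B'_def C'_def using square[OF Bc] square[OF Cc] eq by simp
  have on: "B' $$ (i,i) = C' $$ (i,i)" if i: "i < n" for i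
  proof -
    have "(\<Sum>k<n. B' $$ (i,k) * B' $$ (k,i)) = (\<Sum>k<n. C' $$ (i,k) * C' $$ (k,i))"
      using arg_cong[OF sq, of "\<lambda>M. M $$ (i,i)"]
      unfolding index_mult_mat_sum[OF B'c B'c i i] index_mult_mat_sum[OF C'c C'c i i] .
    moreover have "(\<Sum>k\<in>{..<n} - {i}. B' $$ (i,k) * B' $$ (k,i)) = (\<Sum>k\<in>{..<n} - {i}. C' $$ (i,k) * C' $$ (k,i))"
      using i by (intro sum.cong) (auto simp: off)
    ultimately have "B' $$ (i,i) * B' $$ (i,i) = C' $$ (i,i) * C' $$ (i,i)"
      using i by (simp add: sum.remove[of "{..<n}" i])
    then have "(Re (B' $$ (i,i)))\<^sup>2 = (Re (C' $$ (i,i)))\<^sup>2"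
      using psd_mat_diag(1)[OF B' i] psd_mat_diag(1)[OF C' i]
      by (metis of_real_eq_iff of_real_mult power2_eq_square)
    then have "Re (B' $$ (i,i)) = Re (C' $$ (i,i))"
      using psd_mat_diag(2)[OF B' i] psd_mat_diag(2)[OF C' i] by (simp add: power2_eq_iff_nonneg)
    then show ?thesis using psd_mat_diag(1)[OF B' i] psd_mat_diag(1)[OF C' i] by simp
  qed
  have "B' $$ (i,j) = C' $$ (i,j)" if "i < n" "j < n" for i j
    using that off on by (cases "i = j") auto
  then have "B' = C'" using B'c C'c by (intro eq_matI) auto
  moreover have "X = U * (?Ua * X * U) * ?Ua" if X: "X \<in> carrier_mat n n" for X
  proof -
    have "U * (?Ua * X * U) * ?Ua = (U * ?Ua) * X * (U * ?Ua)" using U Ua X by (simp add: assoc)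
    then show ?thesis using X by (simp add: UU')
  qed
  ultimately show ?thesis using Bc Cc unfolding B'_def C'_def by metis
qed

text \<open>Existence and uniqueness make the \<open>THE\<close> in the definition denote; this is
  the only access to \<open>trace_norm\<close>.\<close>

lemma mat_sqrt:
  assumes A: "psd_mat n A"
  shows "psd_mat n (mat_sqrt A) \<and> mat_sqrt A * mat_sqrt A = A"
proof -
  have "dim_row A = n" using A by (auto simp: psd_mat_def)
  moreover have "\<exists>!B. psd_mat n B \<and> B * B = A"
    using psd_sqrt_exists[OF A] psd_sqrt_unique by metis
  ultimately show ?thesis unfolding mat_sqrt_def using theI'[of "\<lambda>B. psd_mat n B \<and> B * B = A"] by simp
qed

section \<open>The trace norm and the entries of a matrix\<close>

lemma gram_diag:
  fixes A :: "complex mat"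
  assumes A: "A \<in> carrier_mat n n" and i: "i < n"
  shows "(mat_adjoint A * A) $$ (i,i) = complex_of_real (\<Sum>k<n. (cmod (A $$ (k,i)))\<^sup>2)"
proof -
  have "(mat_adjoint A * A) $$ (i,i) = (\<Sum>k<n. mat_adjoint A $$ (i,k) * A $$ (k,i))"
    by (rule index_mult_mat_sum[OF _ A i i]) (use A in simp)
  also have "\<dots> = (\<Sum>k<n. complex_of_real ((cmod (A $$ (k,i)))\<^sup>2))"
    using A i by (intro sum.cong) (auto simp: mat_adjoint_index complex_norm_square simp del: of_real_power)
  finally show ?thesis by simp
qed

lemma sum_power2_le:
  fixes f :: "'a \<Rightarrow> real"
  assumes "\<And>x. x \<in> A \<Longrightarrow> 0 \<le> f x"
  shows "(\<Sum>x\<in>A. (f x)\<^sup>2) \<le> (\<Sum>x\<in>A. f x)\<^sup>2"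
  using assms
proof (induction A rule: infinite_finite_induct)
  case (insert x A)
  have "0 \<le> f x * (\<Sum>x\<in>A. f x)" using insert.prems by (intro mult_nonneg_nonneg sum_nonneg) auto
  then show ?case using insert by (simp add: power2_sum)
qed auto

text \<open>The Gram matrices of |X| and X agree, so their i-th columns have the same Euclidean
  norm. The i-th diagonal entry of |X| is at most this norm, hence at most the sum of the absolute
  values in column i of X.\<close>

lemma trace_norm_le_sum_cmod:
  assumes X: "X \<in> carrier_mat n n"
  shows "trace_norm X \<le> (\<Sum>i<n. \<Sum>k<n. cmod (X $$ (k,i)))"
    and "0 \<le> trace_norm X"
proof -
  define B where "B = mat_sqrt (mat_adjoint X * X)"
  from psd_mat_congruence[OF psd_one_mat X] have "psd_mat n (mat_adjoint X * X)" using X by simp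
  from mat_sqrt[OF this] have B: "psd_mat n B" and BB: "B * B = mat_adjoint X * X" by (auto simp: B_def)
  have Bc: "B \<in> carrier_mat n n" and Bh: "mat_adjoint B = B" using B by (auto simp: psd_mat_def)
  have tn: "trace_norm X = (\<Sum>i<n. Re (B $$ (i,i)))"
    using Bc unfolding trace_norm_def mtrace_def B_def[symmetric] by (simp add: Re_sum)
  show "0 \<le> trace_norm X" unfolding tn using psd_mat_diag(2)[OF B] by (auto intro: sum_nonneg)
  show "trace_norm X \<le> (\<Sum>i<n. \<Sum>k<n. cmod (X $$ (k,i)))"
    unfolding tn
  proof (rule sum_mono)
    fix i assume "i \<in> {..<n}"
    then have i: "i < n" by simp
    have "(\<Sum>k<n. (cmod (B $$ (k,i)))\<^sup>2) = (\<Sum>k<n. (cmod (X $$ (k,i)))\<^sup>2)"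
      using gram_diag[OF Bc i] gram_diag[OF X i] BB Bh by (metis of_real_eq_iff)
    moreover have "(cmod (B $$ (i,i)))\<^sup>2 \<le> (\<Sum>k<n. (cmod (B $$ (k,i)))\<^sup>2)"
      using i by (intro member_le_sum) auto
    moreover have "(\<Sum>k<n. (cmod (X $$ (k,i)))\<^sup>2) \<le> (\<Sum>k<n. cmod (X $$ (k,i)))\<^sup>2"
      by (rule sum_power2_le) simp
    ultimately have "(cmod (B $$ (i,i)))\<^sup>2 \<le> (\<Sum>k<n. cmod (X $$ (k,i)))\<^sup>2" by linarith
    then have "cmod (B $$ (i,i)) \<le> (\<Sum>k<n. cmod (X $$ (k,i)))"
      by (rule power2_le_imp_le) (auto intro: sum_nonneg)
    then show "Re (B $$ (i,i)) \<le> (\<Sum>k<n. cmod (X $$ (k,i)))"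
      using complex_Re_le_cmod order_trans by blast
  qed
qed

section \<open>Chernoff bounds and the classical test\<close>

text \<open>For y = -x < 0 the claim amounts to 1 <= (1 - x + x^2) exp x. Replacing exp x by its
  quadratic Taylor polynomial already suffices, since the product is then 1 + (x^2 + x^3 + x^4) /
  2.\<close>

lemma exp_le_quadratic:
  fixes y :: real assumes "\<bar>y\<bar> \<le> 1" shows "exp y \<le> 1 + y + y\<^sup>2"
proof (cases "y \<ge> 0")
  case True
  then show ?thesis using exp_bound assms by simp
next
  case False
  define x where "x = - y"
  have x: "0 \<le> x" using False by (simp add: x_def)
  have "1 \<le> (1 - x + x\<^sup>2) * (1 + x + x\<^sup>2 / 2)"
  proof -
    have "(1 - x + x\<^sup>2) * (1 + x + x\<^sup>2 / 2) = 1 + x^2/2 + x^3/2 + x^4/2"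
      by (simp add: field_simps power2_eq_square power3_eq_cube power4_eq_xxxx)
    then show ?thesis using x by simp
  qed
  also have "\<dots> \<le> (1 - x + x\<^sup>2) * exp x"
  proof (rule mult_left_mono)
    show "1 + x + x\<^sup>2 / 2 \<le> exp x" using exp_lower_Taylor_quadratic[OF x] .
    have "0 \<le> (1 - x)\<^sup>2 + x" using x by simp
    also have "(1 - x)\<^sup>2 + x = 1 - x + x\<^sup>2" by (simp add: power2_eq_square algebra_simps)
    finally show "0 \<le> 1 - x + x\<^sup>2" .
  qed
  finally have "exp (- x) \<le> 1 - x + x\<^sup>2" by (simp add: exp_minus field_simps)
  then show ?thesis by (simp add: x_def)
qed

section \<open>Product distributions and exponential tilting\<close>

abbreviation strings :: "nat \<Rightarrow> 'a set \<Rightarrow> 'a list set" where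
  "strings m A \<equiv> {xs. set xs \<subseteq> A \<and> length xs = m}"

text \<open>Distributivity, used twice: with probabilities it gives total mass one, with tilted
  weights it factors the moment generating function.\<close>

lemma sum_prod_list_strings:
  fixes h :: "'a \<Rightarrow> 'b :: comm_semiring_1"
  assumes "finite A"
  shows "(\<Sum>xs \<in> strings m A. \<Prod>x\<leftarrow>xs. h x) = (\<Sum>x\<in>A. h x) ^ m"
proof (induction m)
  case 0
  have "strings 0 A = {[]}" by auto
  then show ?case by simp
next
  case (Suc m)
  have eq: "strings (Suc m) A = (\<lambda>(x, xs). x # xs) ` (A \<times> strings m A)"
    by (auto simp: length_Suc_conv image_iff)
  have "inj_on (\<lambda>(x, xs). x # xs) (A \<times> strings m A)" by (auto simp: inj_on_def)
  then have "(\<Sum>xs \<in> strings (Suc m) A. \<Prod>x\<leftarrow>xs. h x) =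
      (\<Sum>(x, xs) \<in> A \<times> strings m A. h x * (\<Prod>x\<leftarrow>xs. h x))"
    unfolding eq by (subst sum.reindex) (auto intro: sum.cong)
  also have "\<dots> = (\<Sum>x\<in>A. h x) * (\<Sum>xs \<in> strings m A. \<Prod>x\<leftarrow>xs. h x)"
    by (simp add: sum_product sum.cartesian_product)
  finally show ?case using Suc by simp
qed

text \<open>Markov's inequality for tilted weights. After centring, the linear term of
  \<open>exp_le_quadratic\<close> averages to zero and leaves a factor 1 + l^2 per letter; the
  bounds on \<open>g\<close> and \<open>l\<close> keep the argument of exp within [-1, 1]. Only an
  inclusion is asked of \<open>R\<close>, so that the complement of a union of events fits as
  well.\<close>

lemma chernoff_strings:
  fixes q g :: "'a \<Rightarrow> real"
  assumes fin: "finite A" and q0: "\<And>x. x \<in> A \<Longrightarrow> 0 \<le> q x" and q1: "(\<Sum>x\<in>A. q x) = 1"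
    and \<mu>: "\<mu> = (\<Sum>x\<in>A. q x * g x)" and bnd: "\<And>x. x \<in> A \<Longrightarrow> \<bar>g x - \<mu>\<bar> \<le> 1"
    and l: "0 \<le> l" "l \<le> 1"
    and R: "R \<subseteq> {xs \<in> strings m A. t \<le> (\<Sum>x\<leftarrow>xs. g x) - real m * \<mu>}"
  shows "(\<Sum>xs\<in>R. \<Prod>x\<leftarrow>xs. q x) \<le> exp (- l * t + real m * l\<^sup>2)"
proof -
  have finS: "finite (strings m A)" using finite_lists_length_eq[OF fin] .
  define h where "h x = q x * exp (l * (g x - \<mu>))" for x
  have h0: "0 \<le> h x" if "x \<in> A" for x using q0[OF that] by (simp add: h_def)
  have prod_h: "(\<Prod>x\<leftarrow>xs. h x) = (\<Prod>x\<leftarrow>xs. q x) * exp (l * ((\<Sum>x\<leftarrow>xs. g x) - real (length xs) * \<mu>))" for xs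
    by (induction xs) (auto simp: h_def algebra_simps exp_add exp_diff)
  have prod0: "0 \<le> (\<Prod>x\<leftarrow>xs. f x)" if "set xs \<subseteq> A" "\<And>x. x \<in> A \<Longrightarrow> 0 \<le> f x" for f :: "'a \<Rightarrow> real" and xs
    using that(1) by (induction xs) (auto simp: that(2))
  have "(\<Sum>xs\<in>R. \<Prod>x\<leftarrow>xs. q x) \<le> (\<Sum>xs\<in>R. exp (- l * t) * (\<Prod>x\<leftarrow>xs. h x))"
  proof (rule sum_mono)
    fix xs assume "xs \<in> R"
    then have xs: "set xs \<subseteq> A" "length xs = m" "t \<le> (\<Sum>x\<leftarrow>xs. g x) - real m * \<mu>" using R by auto
    have "1 \<le> exp (- l * t) * exp (l * ((\<Sum>x\<leftarrow>xs. g x) - real m * \<mu>))"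
      using mult_left_mono[OF xs(3) l(1)] by (simp flip: exp_add)
    from mult_left_mono[OF this prod0[OF xs(1), of q]] q0
    show "(\<Prod>x\<leftarrow>xs. q x) \<le> exp (- l * t) * (\<Prod>x\<leftarrow>xs. h x)"
      unfolding prod_h xs(2) by (simp add: ac_simps)
  qed
  also have "\<dots> \<le> (\<Sum>xs\<in>strings m A. exp (- l * t) * (\<Prod>x\<leftarrow>xs. h x))"
    by (rule sum_mono2[OF finS]) (use R h0 prod0 in auto)
  also have "\<dots> = exp (- l * t) * (\<Sum>x\<in>A. h x) ^ m"
    by (simp add: sum_distrib_left[symmetric] sum_prod_list_strings[OF fin])
  also have "\<dots> \<le> exp (- l * t) * exp (l\<^sup>2) ^ m"
  proof (intro mult_left_mono power_mono)
    have "(\<Sum>x\<in>A. h x) \<le> (\<Sum>x\<in>A. q x * (1 + l * (g x - \<mu>) + l\<^sup>2))"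
    proof (rule sum_mono)
      fix x assume x: "x \<in> A"
      have "\<bar>l * (g x - \<mu>)\<bar> \<le> 1 * 1"
        unfolding abs_mult using l bnd[OF x] by (intro mult_mono) auto
      then have "exp (l * (g x - \<mu>)) \<le> 1 + l * (g x - \<mu>) + (l * (g x - \<mu>))\<^sup>2"
        by (intro exp_le_quadratic) simp
      also have "(l * (g x - \<mu>))\<^sup>2 \<le> l\<^sup>2"
        using bnd[OF x] by (simp add: power_mult_distrib abs_square_le_1 mult_left_le)
      finally show "h x \<le> q x * (1 + l * (g x - \<mu>) + l\<^sup>2)"
        unfolding h_def using q0[OF x] by (intro mult_left_mono) auto
    qed
    also have "\<dots> = (1 + l\<^sup>2 - l * \<mu>) * (\<Sum>x\<in>A. q x) + l * (\<Sum>x\<in>A. q x * g x)"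
      by (simp add: sum_distrib_left sum_distrib_right sum.distrib sum_subtractf algebra_simps)
    also have "\<dots> = 1 + l\<^sup>2" using q1 \<mu> by simp
    also have "\<dots> \<le> exp (l\<^sup>2)" by (rule exp_ge_add_one_self)
    finally show "(\<Sum>x\<in>A. h x) \<le> exp (l\<^sup>2)" .
  qed (auto intro: sum_nonneg h0)
  also have "\<dots> = exp (- l * t + real m * l\<^sup>2)"
    by (simp only: exp_add exp_of_nat_mult)
  finally show ?thesis .
qed


text \<open>For a distribution \<open>p\<close>, the maximum over S of the frequency of S minus its
  \<open>p\<close>-mass is the total variation distance between the empirical distribution and
  \<open>p\<close>; for m > 0, rejection means that it is at least C / sqrt m. Quantifying over all
  S keeps the region independent of the alternative.\<close>

definition reject_region :: "'a set \<Rightarrow> ('a \<Rightarrow> real) \<Rightarrow> real \<Rightarrow> nat \<Rightarrow> 'a list set" where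
  "reject_region A p C m = {xs \<in> strings m A. \<exists>S\<subseteq>A.
     C * sqrt (real m) \<le> (\<Sum>x\<leftarrow>xs. of_bool (x \<in> S)) - real m * (\<Sum>x\<in>S. p x)}"

lemma sum_mult_of_bool:
  fixes p :: "'a \<Rightarrow> real"
  assumes "finite A" "S \<subseteq> A"
  shows "(\<Sum>x\<in>A. p x * of_bool (x \<in> S)) = (\<Sum>x\<in>S. p x)"
proof -
  have "A \<inter> {x. x \<in> S} = S" using assms(2) by auto
  then show ?thesis using assms by simp
qed

text \<open>A union bound over the subsets. The tilt l = 1 / sqrt m turns m l^2 into 1 and l t into
  C, so the bound is uniform in m.\<close>

lemma reject_region_false_positive:
  fixes p :: "'a \<Rightarrow> real"
  assumes fin: "finite A" and p0: "\<And>x. x \<in> A \<Longrightarrow> 0 \<le> p x" and p1: "(\<Sum>x\<in>A. p x) = 1"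
    and m: "0 < m"
  shows "(\<Sum>xs\<in>reject_region A p C m. \<Prod>x\<leftarrow>xs. p x) \<le> 2 ^ card A * exp (1 - C)"
proof -
  define R where "R S = {xs \<in> strings m A.
     C * sqrt (real m) \<le> (\<Sum>x\<leftarrow>xs. of_bool (x \<in> S)) - real m * (\<Sum>x\<in>S. p x)}" for S
  have finR: "finite (R S)" for S
    unfolding R_def by (rule finite_subset[OF _ finite_lists_length_eq[OF fin, of m]]) auto
  have bound: "(\<Sum>xs\<in>R S. \<Prod>x\<leftarrow>xs. p x) \<le> exp (1 - C)" if S: "S \<subseteq> A" for S
  proof -
    have *: "(\<Sum>x\<in>S. p x) \<le> 1" using sum_mono2[OF fin S, of p] p0 p1 by auto
    have **: "0 \<le> (\<Sum>x\<in>S. p x)" using S p0 by (intro sum_nonneg) auto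
    have "(\<Sum>xs\<in>R S. \<Prod>x\<leftarrow>xs. p x) \<le>
        exp (- (1 / sqrt (real m)) * (C * sqrt (real m)) + real m * (1 / sqrt (real m))\<^sup>2)"
      by (rule chernoff_strings[OF fin p0 p1, where g = "\<lambda>x. of_bool (x \<in> S)" and \<mu> = "\<Sum>x\<in>S. p x"])
        (use m * ** in \<open>auto simp: R_def sum_mult_of_bool[OF fin S]\<close>)
    also have "\<dots> = exp (1 - C)" using m by (simp add: power_divide)
    finally show ?thesis .
  qed
  have "reject_region A p C m = (\<Union>S\<in>Pow A. R S)"
    unfolding reject_region_def R_def by auto
  then have "(\<Sum>xs\<in>reject_region A p C m. \<Prod>x\<leftarrow>xs. p x) \<le> (\<Sum>S\<in>Pow A. \<Sum>xs\<in>R S. \<Prod>x\<leftarrow>xs. p x)"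
  proof -
    \<comment> \<open>The sets \<open>R S\<close> overlap; their union is the projection of the
      disjoint union \<open>SIGMA\<close>, and projecting can only lose mass.\<close>
    have "(\<Sum>xs\<in>(\<Union>S\<in>Pow A. R S). \<Prod>x\<leftarrow>xs. p x) = (\<Sum>xs\<in>snd ` (SIGMA S:Pow A. R S). \<Prod>x\<leftarrow>xs. p x)"
      by (simp only: snd_image_Sigma)
    also have "\<dots> \<le> (\<Sum>z\<in>(SIGMA S:Pow A. R S). \<Prod>x\<leftarrow>snd z. p x)"
    proof (rule sum_image_le[where g = "\<lambda>xs. \<Prod>x\<leftarrow>xs. p x" and f = snd, unfolded o_def])
      show "finite (SIGMA S:Pow A. R S)" using fin finR by auto
      fix z assume "z \<in> (SIGMA S:Pow A. R S)"
      then have "set (snd z) \<subseteq> A" by (auto simp: R_def)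
      then show "0 \<le> (\<Prod>x\<leftarrow>snd z. p x)" by (intro prod_list_nonneg) (use p0 in auto)
    qed
    also have "\<dots> = (\<Sum>S\<in>Pow A. \<Sum>xs\<in>R S. \<Prod>x\<leftarrow>xs. p x)"
      using fin finR by (subst sum.Sigma) (auto simp: case_prod_beta)
    finally show ?thesis using \<open>reject_region A p C m = _\<close> by simp
  qed
  also have "\<dots> \<le> (\<Sum>S\<in>Pow A. exp (1 - C))" by (intro sum_mono bound) auto
  also have "\<dots> = 2 ^ card A * exp (1 - C)" using fin by (simp add: card_Pow)
  finally show ?thesis .
qed

text \<open>Acceptance keeps the frequency of S = {p <= q} below p(S) + C / sqrt m, whereas its mean
  q(S) is at least p(S) + \<delta>. This is a lower deviation, so the Chernoff bound is applied to
  the negated indicator.\<close>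

lemma reject_region_false_negative:
  fixes p q :: "'a \<Rightarrow> real"
  assumes fin: "finite A" and p1: "(\<Sum>x\<in>A. p x) = 1"
    and q0: "\<And>x. x \<in> A \<Longrightarrow> 0 \<le> q x" and q1: "(\<Sum>x\<in>A. q x) = 1"
    and \<delta>: "0 \<le> \<delta>" "\<delta> \<le> 1" "2 * \<delta> \<le> (\<Sum>x\<in>A. \<bar>q x - p x\<bar>)"
  shows "(\<Sum>xs\<in>strings m A - reject_region A p C m. \<Prod>x\<leftarrow>xs. q x)
    \<le> exp (- real m * \<delta>\<^sup>2 / 4 + \<delta> * C / 2 * sqrt (real m))"
proof -
  define S where "S = {x \<in> A. p x \<le> q x}"
  have S: "S \<subseteq> A" by (auto simp: S_def)
  \<comment> \<open>As |y| = 2 max(y, 0) - y and q - p has total mass zero, the l1 distance is twice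
    q(S) - p(S).\<close>
  have "(\<Sum>x\<in>A. \<bar>q x - p x\<bar>) = (\<Sum>x\<in>A. 2 * ((q x - p x) * of_bool (x \<in> S)) - (q x - p x))"
    by (rule sum.cong) (auto simp: S_def)
  also have "\<dots> = 2 * (\<Sum>x\<in>S. q x - p x)"
    by (simp only: sum_subtractf sum_distrib_left[symmetric] sum_mult_of_bool[OF fin S] p1 q1)
  finally have dS: "\<delta> \<le> (\<Sum>x\<in>S. q x) - (\<Sum>x\<in>S. p x)" using \<delta>(3) by (simp add: sum_subtractf)
  have *: "(\<Sum>x\<in>S. q x) \<le> 1" using sum_mono2[OF fin S, of q] q0 q1 by auto
  have **: "0 \<le> (\<Sum>x\<in>S. q x)" using S q0 by (intro sum_nonneg) auto
  have neg: "(\<Sum>x\<leftarrow>xs. - of_bool (x \<in> S)) = - (\<Sum>x\<leftarrow>xs. of_bool (x \<in> S) :: real)" for xs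
    by (induction xs) auto
  \<comment> \<open>The tilt l = \<delta>/2 minimises -l \<delta> + l^2, the part of the exponent
    that is linear in m. The threshold can be negative for small m; the Chernoff bound covers every
    real threshold.\<close>
  have "(\<Sum>xs\<in>strings m A - reject_region A p C m. \<Prod>x\<leftarrow>xs. q x) \<le>
      exp (- (\<delta> / 2) * (real m * \<delta> - C * sqrt (real m)) + real m * (\<delta> / 2)\<^sup>2)"
  proof (rule chernoff_strings[OF fin q0 q1, where g = "\<lambda>x. - of_bool (x \<in> S)" and \<mu> = "- (\<Sum>x\<in>S. q x)"])
    show "strings m A - reject_region A p C m \<subseteq> {xs \<in> strings m A.
      real m * \<delta> - C * sqrt (real m) \<le> (\<Sum>x\<leftarrow>xs. - of_bool (x \<in> S)) - real m * - (\<Sum>x\<in>S. q x)}"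
    proof safe
      fix xs assume xs: "set xs \<subseteq> A" "m = length xs" "xs \<notin> reject_region A p C (length xs)"
      then have "\<not> C * sqrt (real m) \<le> (\<Sum>x\<leftarrow>xs. of_bool (x \<in> S)) - real m * (\<Sum>x\<in>S. p x)"
        using S unfolding reject_region_def by blast
      with mult_left_mono[OF dS, of "real m"]
      show "real (length xs) * \<delta> - C * sqrt (real (length xs)) \<le>
          (\<Sum>x\<leftarrow>xs. - of_bool (x \<in> S)) - real (length xs) * - (\<Sum>x\<in>S. q x)"
        unfolding neg xs(2) by (simp add: algebra_simps)
    qed
    show "- (\<Sum>x\<in>S. q x) = (\<Sum>x\<in>A. q x * - of_bool (x \<in> S))"
      using sum_mult_of_bool[OF fin S, of q] by (simp only: mult_minus_right sum_negf)
  qed (use * ** \<delta> in auto)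
  also have "\<dots> = exp (- real m * \<delta>\<^sup>2 / 4 + \<delta> * C / 2 * sqrt (real m))"
    by (simp add: field_simps power2_eq_square)
  finally show ?thesis .
qed

section \<open>Tensor powers and independent measurements\<close>

lemma mtrace_mult:
  assumes "A \<in> carrier_mat n m" "B \<in> carrier_mat m n"
  shows "mtrace (A * B) = (\<Sum>i<n. \<Sum>k<m. A $$ (i,k) * B $$ (k,i))"
proof -
  have "mtrace (A * B) = (\<Sum>i<n. (A * B) $$ (i,i))" using assms by (simp add: mtrace_def)
  also have "\<dots> = (\<Sum>i<n. \<Sum>k<m. A $$ (i,k) * B $$ (k,i))"
    by (intro sum.cong refl index_mult_mat_sum[OF assms]) auto
  finally show ?thesis .
qed

text \<open>Decodes the indices of \<open>kron\<close>, which are numbers standing for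
  pairs.\<close>

lemma sum_div_mod:
  fixes f :: "nat \<Rightarrow> nat \<Rightarrow> 'a :: comm_monoid_add"
  shows "(\<Sum>i<a * b. f (i div b) (i mod b)) = (\<Sum>x<a. \<Sum>y<b. f x y)"
proof (cases "b = 0")
  case False
  have "x * b + y < a * b" if "x < a" "y < b" for x y
  proof -
    have "x * b + y < Suc x * b" using that by simp
    also have "\<dots> \<le> a * b" using that by (intro mult_le_mono1) simp
    finally show ?thesis .
  qed
  then have "(\<Sum>i<a * b. f (i div b) (i mod b)) = (\<Sum>(x,y)\<in>{..<a} \<times> {..<b}. f x y)"
    using False
    by (intro sum.reindex_bij_witness[of _ "\<lambda>(x,y). x * b + y" "\<lambda>i. (i div b, i mod b)"])
      (auto simp: less_mult_imp_div_less)
  then show ?thesis by (simp add: sum.cartesian_product)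
qed simp

lemma kron_carrier:
  "A \<in> carrier_mat a a' \<Longrightarrow> B \<in> carrier_mat b b' \<Longrightarrow> kron A B \<in> carrier_mat (a * b) (a' * b')"
  by (auto simp: kron_def)

lemma mtrace_kron:
  assumes A: "A \<in> carrier_mat a a" and B: "B \<in> carrier_mat b b"
  shows "mtrace (kron A B) = mtrace A * mtrace B"
proof -
  have "mtrace (kron A B) = (\<Sum>i<a * b. A $$ (i div b, i div b) * B $$ (i mod b, i mod b))"
    using A B by (simp add: mtrace_def kron_def)
  also have "\<dots> = (\<Sum>x<a. \<Sum>y<b. A $$ (x,x) * B $$ (y,y))" by (rule sum_div_mod)
  finally show ?thesis using A B by (simp add: mtrace_def sum_product)
qed

text \<open>As much of the mixed-product rule as the Born rule requires: only traces are compared,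
  so the quadruple sum over decoded indices merely has to be regrouped.\<close>

lemma mtrace_kron_mult:
  assumes A: "A \<in> carrier_mat a a" and B: "B \<in> carrier_mat b b"
    and C: "C \<in> carrier_mat a a" and D: "D \<in> carrier_mat b b"
  shows "mtrace (kron A B * kron C D) = mtrace (A * C) * mtrace (B * D)"
proof -
  define t where "t x y x' y' = (A $$ (x,x') * B $$ (y,y')) * (C $$ (x',x) * D $$ (y',y))" for x y x' y'
  have "mtrace (kron A B * kron C D) =
      (\<Sum>i<a * b. \<Sum>k<a * b. t (i div b) (i mod b) (k div b) (k mod b))"
    unfolding mtrace_mult[OF kron_carrier[OF A B] kron_carrier[OF C D]] t_def
    using A B C D by (intro sum.cong) (auto simp: kron_def)
  also have "\<dots> = (\<Sum>x<a. \<Sum>y<b. \<Sum>x'<a. \<Sum>y'<b. t x y x' y')"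
    by (simp add: sum_div_mod[where f = "\<lambda>x' y'. t _ _ x' y'"] sum_div_mod[where f = "\<lambda>x y. \<Sum>x'<a. \<Sum>y'<b. t x y x' y'"])
  also have "\<dots> = (\<Sum>x<a. \<Sum>x'<a. \<Sum>y<b. \<Sum>y'<b. t x y x' y')"
    by (intro sum.cong refl sum.swap)
  also have "\<dots> = (\<Sum>x<a. \<Sum>x'<a. \<Sum>y<b. \<Sum>y'<b. (A $$ (x,x') * C $$ (x',x)) * (B $$ (y,y') * D $$ (y',y)))"
    by (simp add: t_def ac_simps)
  also have "\<dots> = mtrace (A * C) * mtrace (B * D)"
    unfolding mtrace_mult[OF A C] mtrace_mult[OF B D]
    by (simp add: sum_distrib_left[symmetric] sum_distrib_right[symmetric])
  finally show ?thesis .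
qed

lemma tensor_list_carrier:
  assumes "\<And>B. B \<in> set Bs \<Longrightarrow> B \<in> carrier_mat d d"
  shows "tensor_list Bs \<in> carrier_mat (d ^ length Bs) (d ^ length Bs)"
  using assms
proof (induction Bs)
  case (Cons B Bs)
  then show ?case
    using kron_carrier[of B d d "tensor_list Bs"] by (simp add: tensor_list_def)
qed (simp add: tensor_list_def)

lemma tensor_pow_carrier: "A \<in> carrier_mat d d \<Longrightarrow> tensor_pow A m \<in> carrier_mat (d ^ m) (d ^ m)"
  using tensor_list_carrier[of "replicate m A" d] by (auto simp: tensor_pow_def)

lemma mtrace_tensor_pow:
  assumes A: "A \<in> carrier_mat d d"
  shows "mtrace (tensor_pow A m) = mtrace A ^ m"
proof (induction m)
  case (Suc m)
  have "tensor_pow A (Suc m) = kron A (tensor_pow A m)" by (simp add: tensor_pow_def tensor_list_def)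
  then show ?case using mtrace_kron[OF A tensor_pow_carrier[OF A]] Suc by simp
qed (simp add: tensor_pow_def tensor_list_def mtrace_def)

text \<open>The reason why separate measurements of identical copies have independent
  outcomes.\<close>

lemma mtrace_tensor_pow_mult:
  assumes A: "A \<in> carrier_mat d d" and "\<And>B. B \<in> set Bs \<Longrightarrow> B \<in> carrier_mat d d"
  shows "mtrace (tensor_pow A (length Bs) * tensor_list Bs) = (\<Prod>B\<leftarrow>Bs. mtrace (A * B))"
  using assms(2)
proof (induction Bs)
  case Nil
  then show ?case by (simp add: tensor_pow_def tensor_list_def mtrace_def)
next
  case (Cons B Bs)
  have "tensor_pow A (Suc (length Bs)) = kron A (tensor_pow A (length Bs))"
    "tensor_list (B # Bs) = kron B (tensor_list Bs)" by (simp_all add: tensor_pow_def tensor_list_def)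
  then show ?case
    using mtrace_kron_mult[OF A tensor_pow_carrier[OF A] _ tensor_list_carrier] Cons by simp
qed

lemma mtrace_mult_sum:
  assumes R: "R \<in> carrier_mat D D" and fin: "finite S" and T: "\<And>x. x \<in> S \<Longrightarrow> T x \<in> carrier_mat D D"
  shows "mtrace (R * mat D D (\<lambda>(i,j). \<Sum>x\<in>S. if x \<in> Y then T x $$ (i,j) else 0))
    = (\<Sum>x\<in>S \<inter> Y. mtrace (R * T x))" (is "mtrace (R * ?E) = _")
proof -
  have "mtrace (R * ?E) = (\<Sum>i<D. \<Sum>k<D. \<Sum>x\<in>S \<inter> Y. R $$ (i,k) * T x $$ (k,i))"
    unfolding mtrace_mult[OF R mat_carrier]
    by (intro sum.cong refl) (simp add: sum.inter_restrict[OF fin] sum_distrib_left if_distrib cong: if_cong)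
  also have "\<dots> = (\<Sum>i<D. \<Sum>x\<in>S \<inter> Y. \<Sum>k<D. R $$ (i,k) * T x $$ (k,i))"
    by (intro sum.cong refl sum.swap)
  also have "\<dots> = (\<Sum>x\<in>S \<inter> Y. \<Sum>i<D. \<Sum>k<D. R $$ (i,k) * T x $$ (k,i))"
    by (rule sum.swap)
  also have "\<dots> = (\<Sum>x\<in>S \<inter> Y. mtrace (R * T x))"
    by (intro sum.cong refl) (simp add: mtrace_mult[OF R T])
  finally show ?thesis .
qed

lemma mtrace_mult_one_minus:
  assumes R: "R \<in> carrier_mat D D" and E: "E \<in> carrier_mat D D"
  shows "mtrace (R * (1\<^sub>m D - E)) = mtrace R - mtrace (R * E)"
proof -
  have "R * (1\<^sub>m D - E) = R - R * E"
    using mult_minus_distrib_mat[OF R one_carrier_mat E] R by simp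
  then show ?thesis using R E by (simp add: mtrace_def sum_subtractf)
qed

text \<open>\<open>Y\<close> holds the outcome strings that declare H1. The body repeats the matrix
  in \<open>indep_test\<close> with one POVM for all copies, so that independence is a mere
  instantiation.\<close>

definition iid_effect :: "nat \<Rightarrow> complex mat list \<Rightarrow> nat \<Rightarrow> nat list set \<Rightarrow> complex mat" where
  "iid_effect d N m Y = mat (d ^ m) (d ^ m) (\<lambda>(i,j). \<Sum>xs \<in> outcomes (replicate m N).
     if xs \<in> Y then tensor_list (map2 (\<lambda>N x. N ! x) (replicate m N) xs) $$ (i,j) else 0)"

lemma indep_test_iid_effect: "povm d N \<Longrightarrow> indep_test d m (iid_effect d N m Y)"
  unfolding indep_test_def iid_effect_def
  by (intro exI[of _ "replicate m N"] exI[of _ "\<lambda>xs. xs \<in> Y"]) auto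

lemma outcomes_replicate: "outcomes (replicate m N) = strings m {..<length N}"
  by (fastforce simp: outcomes_def set_conv_nth)

text \<open>The passage from quantum to classical errors, used with the nominal state and with the
  alternative as \<open>A\<close>: traces against product effects are string probabilities. The type
  II error is 1 minus the mass of \<open>Y\<close>, where 1 is the mass of all strings.\<close>

lemma
  assumes N: "povm d N" and A: "A \<in> carrier_mat d d"
    and q: "\<And>x. x < length N \<Longrightarrow> mtrace (A * N ! x) = complex_of_real (q x)"
    and q1: "(\<Sum>x<length N. q x) = 1" and tr: "mtrace A = 1"
    and Y: "Y \<subseteq> strings m {..<length N}"
  shows type_I_err_iid_effect: "type_I_err A m (iid_effect d N m Y) = (\<Sum>xs\<in>Y. \<Prod>x\<leftarrow>xs. q x)"
    and type_II_err_iid_effect: "type_II_err A m (iid_effect d N m Y)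
      = (\<Sum>xs\<in>strings m {..<length N} - Y. \<Prod>x\<leftarrow>xs. q x)"
proof -
  let ?S = "strings m {..<length N}"
  have fin: "finite ?S" using finite_lists_length_eq[of "{..<length N}" m] by simp
  have NE: "B \<in> carrier_mat d d" if "B \<in> set N" for B using N that by (auto simp: povm_def psd_mat_def)
  have map2: "map2 (\<lambda>N x. N ! x) (replicate m N) xs = map ((!) N) xs" if "length xs = m" for xs
    using that by (intro nth_equalityI) auto
  have T: "tensor_list (map2 (\<lambda>N x. N ! x) (replicate m N) xs) \<in> carrier_mat (d ^ m) (d ^ m)"
    and trT: "mtrace (tensor_pow A m * tensor_list (map2 (\<lambda>N x. N ! x) (replicate m N) xs))
      = complex_of_real (\<Prod>x\<leftarrow>xs. q x)" if xs: "xs \<in> ?S" for xs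
  proof -
    have carr: "\<And>B. B \<in> set (map ((!) N) xs) \<Longrightarrow> B \<in> carrier_mat d d" using xs NE by fastforce
    show "tensor_list (map2 (\<lambda>N x. N ! x) (replicate m N) xs) \<in> carrier_mat (d ^ m) (d ^ m)"
      using tensor_list_carrier[of "map ((!) N) xs" d, OF carr] xs map2 by simp
    have "mtrace (tensor_pow A m * tensor_list (map2 (\<lambda>N x. N ! x) (replicate m N) xs))
        = (\<Prod>x\<leftarrow>xs. mtrace (A * N ! x))"
      using mtrace_tensor_pow_mult[OF A, of "map ((!) N) xs", OF carr] xs map2 by (simp add: comp_def)
    also have "(\<Prod>x\<leftarrow>xs. mtrace (A * N ! x)) = complex_of_real (\<Prod>x\<leftarrow>xs. q x)"
      if "set xs \<subseteq> {..<length N}" for xs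
      using that by (induction xs) (auto simp: q)
    finally show "mtrace (tensor_pow A m * tensor_list (map2 (\<lambda>N x. N ! x) (replicate m N) xs))
      = complex_of_real (\<Prod>x\<leftarrow>xs. q x)" using xs by simp
  qed
  have Ac: "tensor_pow A m \<in> carrier_mat (d ^ m) (d ^ m)" by (rule tensor_pow_carrier[OF A])
  have YS: "?S \<inter> Y = Y" using Y by auto
  have *: "mtrace (tensor_pow A m * iid_effect d N m Y) = complex_of_real (\<Sum>xs\<in>Y. \<Prod>x\<leftarrow>xs. q x)"
  proof -
    have "mtrace (tensor_pow A m * iid_effect d N m Y) = (\<Sum>xs\<in>?S \<inter> Y.
        mtrace (tensor_pow A m * tensor_list (map2 (\<lambda>N x. N ! x) (replicate m N) xs)))"
      unfolding iid_effect_def outcomes_replicate by (rule mtrace_mult_sum[OF Ac fin T])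
    also have "\<dots> = (\<Sum>xs\<in>Y. complex_of_real (\<Prod>x\<leftarrow>xs. q x))"
      unfolding YS by (intro sum.cong refl trT) (use Y in blast)
    finally show ?thesis by simp
  qed
  then show "type_I_err A m (iid_effect d N m Y) = (\<Sum>xs\<in>Y. \<Prod>x\<leftarrow>xs. q x)"
    by (simp add: type_I_err_def)
  have E: "iid_effect d N m Y \<in> carrier_mat (d ^ m) (d ^ m)" by (simp add: iid_effect_def)
  have "type_II_err A m (iid_effect d N m Y) = 1 - (\<Sum>xs\<in>Y. \<Prod>x\<leftarrow>xs. q x)"
    using A mtrace_mult_one_minus[OF Ac E] mtrace_tensor_pow[OF A] tr * by (simp add: type_II_err_def)
  also have "1 = (\<Sum>xs\<in>?S. \<Prod>x\<leftarrow>xs. q x)" using sum_prod_list_strings[of "{..<length N}" q m] q1 by simp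
  finally show "type_II_err A m (iid_effect d N m Y)
      = (\<Sum>xs\<in>?S - Y. \<Prod>x\<leftarrow>xs. q x)"
    using sum_diff[OF fin Y, of "\<lambda>xs. \<Prod>x\<leftarrow>xs. q x"] by simp
qed

section \<open>The pair measurement\<close>

definition rank_one :: "nat \<Rightarrow> (nat \<Rightarrow> complex) \<Rightarrow> complex mat" where
  "rank_one n u = mat n n (\<lambda>(a,b). u a * cnj (u b))"

text \<open>A congruence of the 1 by 1 identity with the row of conjugates of
  \<open>u\<close>.\<close>

lemma psd_rank_one: "psd_mat n (rank_one n u)"
proof -
  define U where "U = mat 1 n (\<lambda>(_,b). cnj (u b))"
  have U: "U \<in> carrier_mat 1 n" by (simp add: U_def)
  have "mat_adjoint U * 1\<^sub>m 1 * U = rank_one n u"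
  proof (rule eq_matI)
    fix a b assume "a < dim_row (rank_one n u)" "b < dim_col (rank_one n u)"
    then have ab: "a < n" "b < n" by (auto simp: rank_one_def)
    have "(mat_adjoint U * U) $$ (a,b) = (\<Sum>k<1. mat_adjoint U $$ (a,k) * U $$ (k,b))"
      by (rule index_mult_mat_sum[OF _ U ab]) (use U in simp)
    then show "(mat_adjoint U * 1\<^sub>m 1 * U) $$ (a,b) = rank_one n u $$ (a,b)"
      using ab U by (simp add: mat_adjoint_index U_def rank_one_def right_mult_one_mat[of _ n 1])
  qed (auto simp: U_def rank_one_def)
  then show ?thesis using psd_mat_congruence[OF psd_one_mat U] by simp
qed

lemma mtrace_rank_one:
  assumes "A \<in> carrier_mat n n"
  shows "mtrace (A * rank_one n u) = (\<Sum>a<n. \<Sum>b<n. A $$ (a,b) * u b * cnj (u a))"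
proof -
  have R: "rank_one n u \<in> carrier_mat n n" by (simp add: rank_one_def)
  show ?thesis unfolding mtrace_mult[OF assms R]
    by (intro sum.cong refl) (simp add: rank_one_def)
qed

text \<open>The trace is the sole entry of the 1 by 1 congruence of \<open>A\<close> with the column
  \<open>u\<close>, and diagonal entries of positive semidefinite matrices are nonnegative
  reals.\<close>

lemma mtrace_psd_rank_one:
  assumes A: "psd_mat n A"
  shows "mtrace (A * rank_one n u) = complex_of_real (Re (mtrace (A * rank_one n u)))"
    and "0 \<le> Re (mtrace (A * rank_one n u))"
proof -
  have Ac: "A \<in> carrier_mat n n" using A by (simp add: psd_mat_def)
  define V where "V = mat n 1 (\<lambda>(a,_). u a)"
  have V: "V \<in> carrier_mat n 1" and Va: "mat_adjoint V \<in> carrier_mat 1 n" by (simp_all add: V_def)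
  have "(mat_adjoint V * A * V) $$ (0,0) = (mat_adjoint V * (A * V)) $$ (0,0)"
    using assoc_mult_mat[OF Va Ac V] by simp
  also have "\<dots> = (\<Sum>a<n. mat_adjoint V $$ (0,a) * (A * V) $$ (a,0))"
    by (rule index_mult_mat_sum[OF Va mult_carrier_mat[OF Ac V]]) auto
  also have "\<dots> = (\<Sum>a<n. cnj (u a) * (\<Sum>b<n. A $$ (a,b) * u b))"
  proof (intro sum.cong refl)
    fix a assume "a \<in> {..<n}"
    then have a: "a < n" by simp
    have "(A * V) $$ (a,0) = (\<Sum>b<n. A $$ (a,b) * V $$ (b,0))"
      by (rule index_mult_mat_sum[OF Ac V a]) simp
    then show "mat_adjoint V $$ (0,a) * (A * V) $$ (a,0) = cnj (u a) * (\<Sum>b<n. A $$ (a,b) * u b)"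
      using a by (simp add: V_def mat_adjoint_index del: index_mult_mat)
  qed
  also have "\<dots> = mtrace (A * rank_one n u)"
    unfolding mtrace_rank_one[OF Ac] by (simp add: sum_distrib_left ac_simps)
  finally have eq: "(mat_adjoint V * A * V) $$ (0,0) = mtrace (A * rank_one n u)" .
  have "psd_mat 1 (mat_adjoint V * A * V)" by (rule psd_mat_congruence[OF A V])
  from psd_mat_diag[OF this, of 0]
  show "mtrace (A * rank_one n u) = complex_of_real (Re (mtrace (A * rank_one n u)))"
    and "0 \<le> Re (mtrace (A * rank_one n u))" unfolding eq by auto
qed

text \<open>For i = j this is a multiple of (1 + z) e_i, which vanishes at z = -1; a zero effect is
  a legitimate outcome.\<close>

definition pair_vec :: "nat \<Rightarrow> nat \<times> nat \<times> complex \<Rightarrow> nat \<Rightarrow> complex" where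
  "pair_vec d t a = (case t of (i, j, z) \<Rightarrow>
     (of_bool (a = i) + z * of_bool (a = j)) / complex_of_real (sqrt (8 * real d)))"

text \<open>A list, because outcomes are positions: (i,j,1) and (j,i,1) give equal effects and stay
  separate outcomes.\<close>

definition pair_labels :: "nat \<Rightarrow> (nat \<times> nat \<times> complex) list" where
  "pair_labels d = List.product [0..<d] (List.product [0..<d] [1, -1, \<i>, -\<i>])"

text \<open>All ordered pairs (i,j) occur, including i = j. Summing over z kills the cross terms, and
  z = 1, -1 (resp. i, -i) read off the real (resp. imaginary) part of the (i,j) entry of a state.\<close>
definition pair_povm :: "nat \<Rightarrow> complex mat list" where
  "pair_povm d = map (\<lambda>t. rank_one d (pair_vec d t)) (pair_labels d)"

lemma sum_list_product:
  fixes f :: "'a \<times> 'b \<Rightarrow> 'c :: comm_monoid_add"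
  shows "(\<Sum>t\<leftarrow>List.product xs ys. f t) = (\<Sum>x\<leftarrow>xs. \<Sum>y\<leftarrow>ys. f (x, y))"
  by (induction xs) (auto simp: comp_def)

lemma sum_list_pair_labels:
  fixes f :: "nat \<times> nat \<times> complex \<Rightarrow> 'c :: comm_monoid_add"
  shows "(\<Sum>t\<leftarrow>pair_labels d. f t) =
    (\<Sum>i<d. \<Sum>j<d. f (i,j,1) + (f (i,j,-1) + (f (i,j,\<i>) + f (i,j,-\<i>))))"
  unfolding pair_labels_def sum_list_product
  by (simp add: interv_sum_list_conv_sum_set_nat atLeast0LessThan)

lemma pair_labels_mem: "(i,j,z) \<in> set (pair_labels d) \<Longrightarrow> i < d \<and> j < d \<and> z * cnj z = 1"
  by (auto simp: pair_labels_def)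

lemma sum_pair_povm:
  fixes f :: "complex mat \<Rightarrow> 'c :: comm_monoid_add"
  shows "(\<Sum>x<length (pair_povm d). f (pair_povm d ! x)) =
    (\<Sum>t\<leftarrow>pair_labels d. f (rank_one d (pair_vec d t)))"
  using sum_list_sum_nth[of "map f (pair_povm d)"]
  by (simp add: pair_povm_def atLeast0LessThan comp_def)

lemma foldr_mat_index:
  assumes "\<And>E. E \<in> set Es \<Longrightarrow> E \<in> carrier_mat n n"
  shows "foldr (+) Es (0\<^sub>m n n) \<in> carrier_mat n n \<and>
    (\<forall>i<n. \<forall>j<n. foldr (+) Es (0\<^sub>m n n) $$ (i,j) = (\<Sum>E\<leftarrow>Es. E $$ (i,j)))"
  using assms by (induction Es) auto

lemma sqrt_mult_sqrt_complex:
  "complex_of_real (sqrt (8 * real d)) * complex_of_real (sqrt (8 * real d)) = 8 * of_nat d"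
proof -
  have "complex_of_real (sqrt (8 * real d)) * complex_of_real (sqrt (8 * real d)) = complex_of_real (8 * real d)"
    unfolding of_real_mult[symmetric] by simp
  then show ?thesis by simp
qed

lemma povm_pair_povm:
  assumes d: "0 < d"
  shows "povm d (pair_povm d)"
proof -
  note c = sqrt_mult_sqrt_complex[of d]
  have carr: "E \<in> carrier_mat d d" if "E \<in> set (pair_povm d)" for E
    using that by (auto simp: pair_povm_def rank_one_def)
  have "foldr (+) (pair_povm d) (0\<^sub>m d d) = 1\<^sub>m d"
  proof (rule eq_matI)
    fix a b assume "a < dim_row (1\<^sub>m d)" "b < dim_col (1\<^sub>m d)"
    then have ab: "a < d" "b < d" by auto
    have "foldr (+) (pair_povm d) (0\<^sub>m d d) $$ (a,b) = (\<Sum>t\<leftarrow>pair_labels d. rank_one d (pair_vec d t) $$ (a,b))"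
      using foldr_mat_index[of "pair_povm d" d, OF carr] ab by (simp add: pair_povm_def comp_def)
    \<comment> \<open>A pair contributes |e_i><e_i| and |e_j><e_j|, each with weight 4/8d; over all
      pairs every basis vector is hit 2d times.\<close>
    also have "\<dots> = (\<Sum>i<d. \<Sum>j<d. (if i = a then of_bool (a = b) / (2 * of_nat d) else 0)
        + (if j = a then of_bool (a = b) / (2 * of_nat d) else 0))"
      unfolding sum_list_pair_labels
    proof (intro sum.cong refl)
      fix i j
      have entry: "rank_one d (pair_vec d (i,j,z)) $$ (a,b) =
          (of_bool (a = i) + z * of_bool (a = j)) * (of_bool (b = i) + cnj z * of_bool (b = j)) / (8 * of_nat d)" for z
        using ab by (simp add: rank_one_def pair_vec_def c)
      have four: "(x + y) * (u + v) + ((x - y) * (u - v) + ((x + \<i> * y) * (u - \<i> * v) + (x - \<i> * y) * (u + \<i> * v)))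
          = 4 * (x * u + y * v)" for x y u v :: complex
        by (simp add: algebra_simps)
      have "rank_one d (pair_vec d (i,j,1)) $$ (a,b) + (rank_one d (pair_vec d (i,j,-1)) $$ (a,b) +
          (rank_one d (pair_vec d (i,j,\<i>)) $$ (a,b) + rank_one d (pair_vec d (i,j,-\<i>)) $$ (a,b)))
        = 4 * (of_bool (a = i) * of_bool (b = i) + of_bool (a = j) * of_bool (b = j)) / (8 * of_nat d)"
        unfolding entry four[symmetric] by (simp add: add_divide_distrib)
      also have "\<dots> = (if i = a then of_bool (a = b) / (2 * of_nat d) else 0)
          + (if j = a then of_bool (a = b) / (2 * of_nat d) else 0)"
        using d by auto
      finally show "rank_one d (pair_vec d (i,j,1)) $$ (a,b) + (rank_one d (pair_vec d (i,j,-1)) $$ (a,b) +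
          (rank_one d (pair_vec d (i,j,\<i>)) $$ (a,b) + rank_one d (pair_vec d (i,j,-\<i>)) $$ (a,b)))
        = (if i = a then of_bool (a = b) / (2 * of_nat d) else 0)
          + (if j = a then of_bool (a = b) / (2 * of_nat d) else 0)" .
    qed
    also have "\<dots> = 1\<^sub>m d $$ (a,b)"
      using ab d by (simp add: sum.distrib sum_distrib_left[symmetric])
    finally show "foldr (+) (pair_povm d) (0\<^sub>m d d) $$ (a,b) = 1\<^sub>m d $$ (a,b)" .
  qed (use foldr_mat_index[of "pair_povm d" d, OF carr] in auto)
  then show ?thesis unfolding povm_def by (auto simp: pair_povm_def psd_rank_one)
qed

lemma mtrace_pair_vec:
  assumes A: "A \<in> carrier_mat d d" and t: "(i,j,z) \<in> set (pair_labels d)"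
  shows "mtrace (A * rank_one d (pair_vec d (i,j,z))) =
    (A $$ (i,i) + A $$ (j,j) + z * A $$ (i,j) + cnj z * A $$ (j,i)) / (8 * of_nat d)"
proof -
  let ?c = "complex_of_real (sqrt (8 * real d))"
  note c = sqrt_mult_sqrt_complex[of d]
  have ij: "i < d" "j < d" "z * cnj z = 1" using pair_labels_mem[OF t] by auto
  \<comment> \<open>The two indicators are split before summing, which covers i = j too.\<close>
  have pick: "(\<Sum>b<d. f b * (of_bool (b = i) + w * of_bool (b = j))) = f i + w * f j" for f and w :: complex
  proof -
    have "(\<Sum>b<d. f b * (of_bool (b = i) + w * of_bool (b = j))) =
        (\<Sum>b<d. (if b = i then f i else 0) + (if b = j then w * f j else 0))"
      by (intro sum.cong) (auto simp: algebra_simps)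
    then show ?thesis using ij by (simp add: sum.distrib)
  qed
  have "mtrace (A * rank_one d (pair_vec d (i,j,z))) =
      (\<Sum>a<d. (\<Sum>b<d. A $$ (a,b) * (of_bool (b = i) + z * of_bool (b = j)))
        * (of_bool (a = i) + cnj z * of_bool (a = j))) / (?c * ?c)"
    unfolding mtrace_rank_one[OF A] sum_divide_distrib sum_distrib_right
    by (intro sum.cong refl) (simp add: pair_vec_def)
  also have "\<dots> = (A $$ (i,i) + z * A $$ (i,j) + cnj z * (A $$ (j,i) + z * A $$ (j,j))) / (8 * of_nat d)"
    unfolding pick c ..
  also have "cnj z * (A $$ (j,i) + z * A $$ (j,j)) = cnj z * A $$ (j,i) + (z * cnj z) * A $$ (j,j)"
    by (simp add: algebra_simps)
  finally show ?thesis unfolding ij(3) by (simp add: algebra_simps)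
qed

text \<open>For Hermitian \<open>A\<close> the two cross terms are conjugates of each other, so they
  add up to twice a real part.\<close>

lemma Re_mtrace_pair_vec:
  assumes A: "A \<in> carrier_mat d d" "mat_adjoint A = A" and t: "(i,j,z) \<in> set (pair_labels d)"
  shows "Re (mtrace (A * rank_one d (pair_vec d (i,j,z)))) =
    (Re (A $$ (i,i)) + Re (A $$ (j,j)) + 2 * Re (z * A $$ (i,j))) / (8 * real d)"
proof -
  have "A $$ (j,i) = cnj (A $$ (i,j))" by (rule hermitian_index[OF A]) (use pair_labels_mem[OF t] in auto)
  then have "mtrace (A * rank_one d (pair_vec d (i,j,z))) =
      (A $$ (i,i) + A $$ (j,j) + (z * A $$ (i,j) + cnj (z * A $$ (i,j)))) / complex_of_real (8 * real d)"
    unfolding mtrace_pair_vec[OF A(1) t] by (simp add: add.assoc)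
  then show ?thesis unfolding Re_divide_of_real complex_add_cnj by (simp only: Re_divide_of_real plus_complex.sel Re_complex_of_real)
qed

section \<open>Outcome distributions of the pair measurement\<close>

definition pair_prob :: "nat \<Rightarrow> complex mat \<Rightarrow> nat \<Rightarrow> real" where
  "pair_prob d A x = Re (mtrace (A * pair_povm d ! x))"

lemma pair_prob:
  assumes A: "density_op d A" and x: "x < length (pair_povm d)"
  shows "mtrace (A * pair_povm d ! x) = complex_of_real (pair_prob d A x)" "0 \<le> pair_prob d A x"
  using mtrace_psd_rank_one[of d A "pair_vec d (pair_labels d ! x)"] A x
  by (auto simp: density_op_def pair_prob_def pair_povm_def)

lemma pair_labels_mem_iff: "(i,j,z) \<in> set (pair_labels d) \<longleftrightarrow> i < d \<and> j < d \<and> z \<in> {1, -1, \<i>, -\<i>}"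
  by (auto simp: pair_labels_def)

text \<open>Over the four phases the terms Re (z A_ij) cancel. What remains at (i,j) is (A_ii +
  A_jj) / 2d, and summing over all pairs counts the trace 2d times.\<close>

lemma sum_pair_prob:
  assumes A: "density_op d A" and d: "0 < d"
  shows "(\<Sum>x<length (pair_povm d). pair_prob d A x) = 1"
proof -
  have Ac: "A \<in> carrier_mat d d" and Ah: "mat_adjoint A = A" and tr: "(\<Sum>i<d. Re (A $$ (i,i))) = 1"
    using A by (auto simp: density_op_def psd_mat_def mtrace_def simp flip: Re_sum)
  have "(\<Sum>x<length (pair_povm d). pair_prob d A x) = (\<Sum>i<d. \<Sum>j<d. (Re (A $$ (i,i)) + Re (A $$ (j,j))) / (2 * real d))"
    unfolding pair_prob_def sum_pair_povm[where f = "\<lambda>E. Re (mtrace (A * E))"] sum_list_pair_labels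
    using d by (intro sum.cong refl) (simp add: Re_mtrace_pair_vec[OF Ac Ah] pair_labels_mem_iff field_simps)
  also have "\<dots> = 1"
    using d tr by (simp add: sum.distrib sum_divide_distrib[symmetric] sum_distrib_left[symmetric])
  finally show ?thesis .
qed

text \<open>Holds pair by pair: the four outcomes at (i,j) see the entry w of the difference with
  weight 1/8d and together account for at least 4 |w| / 8d.\<close>

lemma sum_pair_prob_diff:
  assumes A: "density_op d A" and B: "density_op d B" and d: "0 < d"
  shows "(\<Sum>i<d. \<Sum>j<d. cmod ((A - B) $$ (i,j))) / (2 * real d)
    \<le> (\<Sum>x<length (pair_povm d). \<bar>pair_prob d B x - pair_prob d A x\<bar>)"
proof -
  have Ac: "A \<in> carrier_mat d d" "mat_adjoint A = A" and Bc: "B \<in> carrier_mat d d" "mat_adjoint B = B"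
    using A B by (auto simp: density_op_def psd_mat_def)
  show ?thesis
    unfolding pair_prob_def sum_divide_distrib
      sum_pair_povm[where f = "\<lambda>E. \<bar>Re (mtrace (B * E)) - Re (mtrace (A * E))\<bar>"] sum_list_pair_labels
  proof (intro sum_mono)
    fix i j assume "i \<in> {..<d}" "j \<in> {..<d}"
    then have ij: "i < d" "j < d" by auto
    define g where "g z = \<bar>Re (mtrace (B * rank_one d (pair_vec d (i,j,z)))) - Re (mtrace (A * rank_one d (pair_vec d (i,j,z))))\<bar>" for z
    define x where "x = Re (A $$ (i,i)) + Re (A $$ (j,j)) - Re (B $$ (i,i)) - Re (B $$ (j,j))"
    define w where "w = (A - B) $$ (i,j)"
    have w: "w = A $$ (i,j) - B $$ (i,j)" using ij Ac Bc by (simp add: w_def)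
    have g: "g z = \<bar>x + 2 * Re (z * w)\<bar> / (8 * real d)" if "z \<in> {1, -1, \<i>, -\<i>}" for z
    proof -
      have t: "(i,j,z) \<in> set (pair_labels d)" using ij that by (simp add: pair_labels_mem_iff)
      have "g z = \<bar>- ((x + 2 * Re (z * w)) / (8 * real d))\<bar>"
        unfolding g_def Re_mtrace_pair_vec[OF Ac t] Re_mtrace_pair_vec[OF Bc t] diff_divide_distrib[symmetric]
        unfolding minus_divide_left
        by (rule arg_cong[where f = "\<lambda>y. \<bar>y / (8 * real d)\<bar>"]) (simp add: x_def w algebra_simps)
      then show ?thesis by (simp add: abs_divide)
    qed
    have "4 * cmod w \<le> 4 * \<bar>Re w\<bar> + 4 * \<bar>Im w\<bar>" using cmod_le[of w] by simp
    \<comment> \<open>Opposite phases are combined: |x + r| + |x - r| >= 2 |r|, whatever the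
      diagonal contribution x.\<close>
    also have "\<dots> \<le> \<bar>x + 2 * Re w\<bar> + (\<bar>x - 2 * Re w\<bar> + (\<bar>x - 2 * Im w\<bar> + \<bar>x + 2 * Im w\<bar>))"
      by linarith
    finally have "4 * cmod w / (8 * real d) \<le> (\<bar>x + 2 * Re w\<bar> + (\<bar>x - 2 * Re w\<bar> + (\<bar>x - 2 * Im w\<bar> + \<bar>x + 2 * Im w\<bar>))) / (8 * real d)"
      by (rule divide_right_mono) simp
    also have "\<dots> = g 1 + (g (-1) + (g \<i> + g (-\<i>)))"
      by (simp add: g add_divide_distrib)
    finally have "4 * cmod w / (8 * real d) \<le> g 1 + (g (-1) + (g \<i> + g (-\<i>)))" .
    moreover have "cmod w / (2 * real d) = 4 * cmod w / (8 * real d)" using d by (simp add: field_simps)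
    ultimately show "cmod ((A - B) $$ (i,j)) / (2 * real d) \<le>
        \<bar>Re (mtrace (B * rank_one d (pair_vec d (i,j,1)))) - Re (mtrace (A * rank_one d (pair_vec d (i,j,1))))\<bar> +
        (\<bar>Re (mtrace (B * rank_one d (pair_vec d (i,j,-1)))) - Re (mtrace (A * rank_one d (pair_vec d (i,j,-1))))\<bar> +
        (\<bar>Re (mtrace (B * rank_one d (pair_vec d (i,j,\<i>)))) - Re (mtrace (A * rank_one d (pair_vec d (i,j,\<i>))))\<bar> +
         \<bar>Re (mtrace (B * rank_one d (pair_vec d (i,j,-\<i>)))) - Re (mtrace (A * rank_one d (pair_vec d (i,j,-\<i>))))\<bar>))"
      by (simp only: g_def w_def)
  qed
qed

theorem theorem4:
  fixes d :: nat and \<rho> :: "complex mat" and \<alpha> :: real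
  assumes "density_op d \<rho>" and "0 < \<alpha>" and "\<alpha> < 1"
  shows "\<exists>M :: nat \<Rightarrow> complex mat.
           (\<forall>m. indep_test d m (M m)) \<and>
           (\<exists>N. \<forall>m \<ge> N. type_I_err \<rho> m (M m) \<le> \<alpha>) \<and>
           (\<forall>\<sigma>. density_op d \<sigma> \<and> \<sigma> \<noteq> \<rho> \<longrightarrow>
              (\<exists>K. \<exists>N. \<forall>m \<ge> N. type_II_err \<sigma> m (M m) \<le>
                 exp (- (real m * (trace_norm (\<rho> - \<sigma>))\<^sup>2) / (86 * real d ^ 3) + K * sqrt (real m))))"
proof -
  note \<rho> = assms(1)
  \<comment> \<open>A 0 by 0 matrix has trace 0, so it is not a density operator.\<close>
  have d: "0 < d" using \<rho> by (cases d) (auto simp: density_op_def psd_mat_def mtrace_def)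
  let ?N = "pair_povm d"
  let ?A = "{..<length ?N}"
  define p where "p = pair_prob d \<rho>"
  \<comment> \<open>The solution of \<open>2 ^ card ?A * exp (1 - C) = \<alpha>\<close>; it depends
    on d and \<alpha> only.\<close>
  define C where "C = 1 + ln (2 ^ card ?A / \<alpha>)"
  define Y where "Y = reject_region ?A p C"
  define M where "M m = iid_effect d ?N m (Y m)" for m
  have Y: "Y m \<subseteq> strings m ?A" for m by (auto simp: Y_def reject_region_def)
  note N = povm_pair_povm[OF d]
  have p: "\<And>x. x \<in> ?A \<Longrightarrow> 0 \<le> p x" "(\<Sum>x\<in>?A. p x) = 1"
    using pair_prob[OF \<rho>] sum_pair_prob[OF \<rho> d] by (auto simp: p_def)
  \<comment> \<open>From m = 1 on, the tilt 1 / sqrt m is positive and at most 1.\<close>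
  have "type_I_err \<rho> m (M m) \<le> \<alpha>" if m: "1 \<le> m" for m
  proof -
    have "type_I_err \<rho> m (M m) = (\<Sum>xs\<in>Y m. \<Prod>x\<leftarrow>xs. p x)"
      unfolding M_def p_def
      by (rule type_I_err_iid_effect[OF N _ _ _ _ Y])
        (use \<rho> pair_prob[OF \<rho>] sum_pair_prob[OF \<rho> d] in \<open>auto simp: density_op_def psd_mat_def\<close>)
    also have "\<dots> \<le> 2 ^ card ?A * exp (1 - C)"
      unfolding Y_def by (rule reject_region_false_positive[OF _ p]) (use m in auto)
    also have "\<dots> = \<alpha>" using assms(2) by (simp add: C_def exp_minus)
    finally show ?thesis .
  qed
  moreover have "\<exists>K. \<exists>N. \<forall>m \<ge> N. type_II_err \<sigma> m (M m) \<le>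
      exp (- (real m * (trace_norm (\<rho> - \<sigma>))\<^sup>2) / (86 * real d ^ 3) + K * sqrt (real m))"
    if \<sigma>: "density_op d \<sigma>" for \<sigma>
  proof -
    define q where "q = pair_prob d \<sigma>"
    have q: "\<And>x. x \<in> ?A \<Longrightarrow> 0 \<le> q x" "(\<Sum>x\<in>?A. q x) = 1"
      using pair_prob[OF \<sigma>] sum_pair_prob[OF \<sigma> d] by (auto simp: q_def)
    define s where "s = (\<Sum>i<d. \<Sum>j<d. cmod ((\<rho> - \<sigma>) $$ (i,j)))"
    have s0: "0 \<le> s" unfolding s_def by (intro sum_nonneg) auto
    \<comment> \<open>Half of s/2d, since the total variation distance is half of the l1
      distance.\<close>
    define \<delta> where "\<delta> = s / (4 * real d)"
    have \<delta>2: "2 * \<delta> \<le> (\<Sum>x\<in>?A. \<bar>q x - p x\<bar>)"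
      using sum_pair_prob_diff[OF \<rho> \<sigma> d] by (simp add: \<delta>_def p_def q_def s_def)
    \<comment> \<open>The l1 distance of two distributions is at most 2; this gives \<delta> <= 1,
      as the type II bound requires.\<close>
    also have "\<dots> \<le> (\<Sum>x\<in>?A. q x + p x)" using p(1) q(1) by (intro sum_mono) (auto simp: abs_le_iff)
    also have "\<dots> = 2" using p(2) q(2) by (simp add: sum.distrib)
    finally have \<delta>1: "\<delta> \<le> 1" by simp
    have \<delta>0: "0 \<le> \<delta>" using s0 by (simp add: \<delta>_def)
    have X: "\<rho> - \<sigma> \<in> carrier_mat d d"
      using \<sigma> by (intro minus_carrier_mat) (simp add: density_op_def psd_mat_def)
    \<comment> \<open>The bound on the trace norm sums column by column, \<open>s\<close> row by
      row; hence the swap.\<close>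
    have "trace_norm (\<rho> - \<sigma>) \<le> s" and "0 \<le> trace_norm (\<rho> - \<sigma>)"
      using trace_norm_le_sum_cmod[OF X] sum.swap[of "\<lambda>i j. cmod ((\<rho> - \<sigma>) $$ (i,j))" "{..<d}" "{..<d}"]
      by (simp_all only: s_def)
    then have tn: "(trace_norm (\<rho> - \<sigma>))\<^sup>2 \<le> s\<^sup>2" by (rule power_mono)
    have "(trace_norm (\<rho> - \<sigma>))\<^sup>2 / (86 * real d ^ 3) \<le> s\<^sup>2 / (64 * (real d)\<^sup>2)"
    proof (rule frac_le[OF _ tn])
      \<comment> \<open>As d >= 1, the claimed rate has a factor d to spare.\<close>
      have "(real d)\<^sup>2 * 64 \<le> (real d)\<^sup>2 * (86 * real d)" using d by (intro mult_left_mono) auto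
      then show "64 * (real d)\<^sup>2 \<le> 86 * real d ^ 3" by (simp add: power2_eq_square power3_eq_cube ac_simps)
    qed (use d in auto)
    also have "\<dots> = \<delta>\<^sup>2 / 4" by (simp add: \<delta>_def power2_eq_square field_simps)
    finally have rate: "(trace_norm (\<rho> - \<sigma>))\<^sup>2 / (86 * real d ^ 3) \<le> \<delta>\<^sup>2 / 4" .
    have "type_II_err \<sigma> m (M m) \<le>
      exp (- (real m * (trace_norm (\<rho> - \<sigma>))\<^sup>2) / (86 * real d ^ 3) + \<delta> * C / 2 * sqrt (real m))" for m
    proof -
      have "type_II_err \<sigma> m (M m) = (\<Sum>xs\<in>strings m ?A - Y m. \<Prod>x\<leftarrow>xs. q x)"
        unfolding M_def q_def
        by (rule type_II_err_iid_effect[OF N _ _ _ _ Y])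
          (use \<sigma> pair_prob[OF \<sigma>] sum_pair_prob[OF \<sigma> d] in \<open>auto simp: density_op_def psd_mat_def\<close>)
      also have "\<dots> \<le> exp (- real m * \<delta>\<^sup>2 / 4 + \<delta> * C / 2 * sqrt (real m))"
        unfolding Y_def by (rule reject_region_false_negative[OF _ p(2) q \<delta>0 \<delta>1 \<delta>2]) auto
      also have "\<dots> \<le> exp (- (real m * (trace_norm (\<rho> - \<sigma>))\<^sup>2) / (86 * real d ^ 3) + \<delta> * C / 2 * sqrt (real m))"
        using mult_left_mono[OF rate, of "real m"] by simp
      finally show ?thesis .
    qed
    \<comment> \<open>The witness for K is \<delta> * C / 2, which depends on \<sigma> through
      \<delta>.\<close>
    then show ?thesis by blast
  qed
  ultimately show ?thesis
    using indep_test_iid_effect[OF N] by (intro exI[of _ M]) (auto simp: M_def)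
qed

end
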